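(* Let $(X,T)$ be the $\mathcal{S}$-adic subshift (not necessarily minimal) generated by an everywhere growing directive sequence $\boldsymbol{\tau} = (\tau_n\colon \mathcal{A}_{n+1}^+\to \mathcal{A}_n^+)_{n\geq 0}$ of finite alphabet rank $K=\liminf_{n\to+\infty}\#\mathcal{A}_n<+\infty$. Then $(X,T)$ has at most $122K^7$ asymptotic classes.
   Context: Alphabets are finite sets. For an alphabet $\mathcal{A}$, $\mathcal{A}^+$ is the free semigroup of nonempty finite words over $\mathcal{A}$ under concatenation, and $|w|$ is the length of a word $w$. A directive sequence is a sequence $\boldsymbol{\tau}=(\tau_n\colon \mathcal{A}_{n+1}^+\to \mathcal{A}_n^+)_{n\ge 0}$ of semigroup morphisms, where each $\mathcal{A}_n$ is an alphabet. For $0\le n<N$ put $\tau_{[n,N)}=\tau_n\circ\tau_{n+1}\circ\cdots\circ\tau_{N-1}$. For a morphism $\tau\colon\mathcal{A}^+\to\mathcal{B}^+$ put $\langle\tau\rangle=\min_{a\in\mathcal{A}}|\tau(a)|$. The sequence $\boldsymbol{\tau}$ is everywhere growing if $\lim_{N\to+\infty}\langle\tau_{[0,N)}\rangle=+\infty$. The $\mathcal{S}$-adic subshift generated by $\boldsymbol{\tau}$ is the set $X=X_{\boldsymbol{\tau}}$ of all $x\in\mathcal{A}_0^{\mathbb{Z}}$ such that for every $k\in\mathbb{N}$ the word $x_{[-k,k]}$ occurs as a (contiguous) subword of $\tau_{[0,N)}(a)$ for some $N>0$ and $a\in\mathcal{A}_N$, together with the left shift $T((x_n)_{n\in\mathbb{Z}})=(x_{n+1})_{n\in\mathbb{Z}}$.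 Two points $x,x'\in X$ are (negatively) asymptotic if $\lim_{n\to-\infty}\mathrm{dist}(T^nx,T^nx')=0$. Write $x\sim x'$ if $x$ is asymptotic to $T^kx'$ for some $k\in\mathbb{Z}$; for a subshift this is equivalent to $x_{(-\infty,k)}=x'_{(-\infty,\ell)}$ for some $k,\ell\in\mathbb{Z}$ (equality as left-infinite sequences). This is an equivalence relation on $X$. An asymptotic class is an equivalence class of $\sim$ that is not the orbit of a single point. *)

theory Defs
  imports Complex_Main "HOL-Library.Sublist" "HOL-Library.Extended_Nat" "HOL-Library.Liminf_Limsup"
begin

definition words :: "'a set \<Rightarrow> 'a list set" where
  "words A = lists A - {[]}"

definition semigroup_morphism :: "'a set \<Rightarrow> 'b set \<Rightarrow> ('a list \<Rightarrow> 'b list) \<Rightarrow> bool" where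
  "semigroup_morphism A B f \<longleftrightarrow>
     (\<forall>u\<in>words A. f u \<in> words B) \<and>
     (\<forall>u\<in>words A. \<forall>v\<in>words A. f (u @ v) = f u @ f v)"

text \<open>All alphabets are subsets of one (arbitrary) type of letters; they need not be disjoint,
  nested or equal. Values of \<open>\<tau> n\<close> outside \<open>words (\<A> (Suc n))\<close> are irrelevant.\<close>

definition directive_sequence ::
    "(nat \<Rightarrow> 'a set) \<Rightarrow> (nat \<Rightarrow> 'a list \<Rightarrow> 'a list) \<Rightarrow> bool" where
  "directive_sequence \<A> \<tau> \<longleftrightarrow>
     (\<forall>n. finite (\<A> n)) \<and> (\<forall>n. semigroup_morphism (\<A> (Suc n)) (\<A> n) (\<tau> n))"

text \<open>\<open>block \<tau> n N = \<tau> n \<circ> \<tau> (n + 1) \<circ> \<dots> \<circ> \<tau> (N - 1)\<close> for \<open>n < N\<close>, the identity otherwise.\<close>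

definition block :: "(nat \<Rightarrow> 'a list \<Rightarrow> 'a list) \<Rightarrow> nat \<Rightarrow> nat \<Rightarrow> 'a list \<Rightarrow> 'a list" where
  "block \<tau> n N = foldr (\<lambda>i f. \<tau> i \<circ> f) [n..<N] id"

definition min_length :: "'a set \<Rightarrow> ('a list \<Rightarrow> 'b list) \<Rightarrow> nat" where
  "min_length A f = Min ((\<lambda>a. length (f [a])) ` A)"

text \<open>If some alphabet of a directive sequence is empty, so are all later ones, and the sequence
  below is eventually the constant \<open>Min {}\<close>. Hence everywhere growing directive sequences only
  have nonempty alphabets.\<close>

definition everywhere_growing ::
    "(nat \<Rightarrow> 'a set) \<Rightarrow> (nat \<Rightarrow> 'a list \<Rightarrow> 'a list) \<Rightarrow> bool" where
  "everywhere_growing \<A> \<tau> \<longleftrightarrow>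
     filterlim (\<lambda>N. min_length (\<A> N) (block \<tau> 0 N)) at_top sequentially"

definition sadic_subshift ::
    "(nat \<Rightarrow> 'a set) \<Rightarrow> (nat \<Rightarrow> 'a list \<Rightarrow> 'a list) \<Rightarrow> (int \<Rightarrow> 'a) set" where
  "sadic_subshift \<A> \<tau> =
     {x. range x \<subseteq> \<A> 0 \<and>
         (\<forall>k::nat. \<exists>N>0. \<exists>a\<in>\<A> N. sublist (map x [- int k..int k]) (block \<tau> 0 N [a]))}"

text \<open>The power \<open>T\<^sup>k\<close> of the left shift for an integer exponent \<open>k\<close>.\<close>

definition shift_pow :: "int \<Rightarrow> (int \<Rightarrow> 'a) \<Rightarrow> int \<Rightarrow> 'a" where
  "shift_pow k x = (\<lambda>n. x (n + k))"

abbreviation shift :: "(int \<Rightarrow> 'a) \<Rightarrow> int \<Rightarrow> 'a" where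
  "shift \<equiv> shift_pow 1"

lemma shift_pow_of_nat: "shift_pow (int m) = shift ^^ m"
  by (induction m) (auto simp: shift_pow_def fun_eq_iff algebra_simps)

lemma shift_pow_0 [simp]: "shift_pow 0 = id"
  by (simp add: shift_pow_def fun_eq_iff)

lemma shift_pow_add: "shift_pow (k + l) = shift_pow k \<circ> shift_pow l"
  by (auto simp: shift_pow_def fun_eq_iff algebra_simps)

text \<open>The standard metric on the two-sided full shift: \<open>2\<^sup>-\<^sup>k\<close> with \<open>k\<close> the least absolute value of
  a coordinate at which the two points differ.\<close>

definition shift_dist :: "(int \<Rightarrow> 'a) \<Rightarrow> (int \<Rightarrow> 'a) \<Rightarrow> real" where
  "shift_dist x y =
     (if x = y then 0 else (1 / 2) ^ (LEAST k::nat. \<exists>n. nat \<bar>n\<bar> = k \<and> x n \<noteq> y n))"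

definition asymptotic :: "(int \<Rightarrow> 'a) \<Rightarrow> (int \<Rightarrow> 'a) \<Rightarrow> bool" where
  "asymptotic x y \<longleftrightarrow> ((\<lambda>n::int. shift_dist (shift_pow n x) (shift_pow n y)) \<longlongrightarrow> 0) at_bot"

definition asymptotic_rel :: "(int \<Rightarrow> 'a) set \<Rightarrow> ((int \<Rightarrow> 'a) \<times> (int \<Rightarrow> 'a)) set" where
  "asymptotic_rel X = {(x, y). x \<in> X \<and> y \<in> X \<and> (\<exists>k. asymptotic x (shift_pow k y))}"

definition orbit :: "(int \<Rightarrow> 'a) \<Rightarrow> (int \<Rightarrow> 'a) set" where
  "orbit x = range (\<lambda>k. shift_pow k x)"

definition asymptotic_classes :: "(int \<Rightarrow> 'a) set \<Rightarrow> (int \<Rightarrow> 'a) set set" where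
  "asymptotic_classes X = {C \<in> X // asymptotic_rel X. \<not> (\<exists>x\<in>X. C = orbit x)}"

lemma shift_dist_le_half_power_iff:
  "shift_dist x y \<le> (1 / 2) ^ m \<longleftrightarrow> (\<forall>n. nat \<bar>n\<bar> < m \<longrightarrow> x n = y n)"
proof (cases "x = y")
  case False
  define P where "P k \<longleftrightarrow> (\<exists>n. nat \<bar>n\<bar> = k \<and> x n \<noteq> y n)" for k
  have ex: "\<exists>k. P k" using False by (auto simp: P_def fun_eq_iff)
  have "shift_dist x y \<le> (1 / 2) ^ m \<longleftrightarrow> m \<le> (LEAST k. P k)"
    using False by (simp add: shift_dist_def P_def[symmetric] power_decreasing_iff)
  also have "\<dots> \<longleftrightarrow> (\<forall>k<m. \<not> P k)"
    using ex by (meson LeastI_ex Least_le not_le not_less_Least order_less_le_trans)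
  finally show ?thesis by (auto simp: P_def)
qed (simp add: shift_dist_def)

lemma asymptotic_iff: "asymptotic x y \<longleftrightarrow> (\<exists>l. \<forall>n<l. x n = y n)"
proof
  assume "asymptotic x y"
  then have "eventually (\<lambda>n. shift_dist (shift_pow n x) (shift_pow n y) < (1 / 2) ^ 1) at_bot"
    unfolding asymptotic_def by (rule order_tendstoD) simp
  then obtain l where "\<forall>n\<le>l. shift_dist (shift_pow n x) (shift_pow n y) < (1 / 2) ^ 1"
    by (auto simp: eventually_at_bot_linorder)
  then have "\<forall>n\<le>l. shift_dist (shift_pow n x) (shift_pow n y) \<le> (1 / 2) ^ 1"
    by (meson less_imp_le)
  then have "\<forall>n\<le>l. x n = y n"
    unfolding shift_dist_le_half_power_iff shift_pow_def
    by (metis abs_zero add_0 less_one nat_0)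
  then show "\<exists>l. \<forall>n<l. x n = y n" by (meson less_imp_le)
next
  assume "\<exists>l. \<forall>n<l. x n = y n"
  then obtain l where l: "\<And>n. n < l \<Longrightarrow> x n = y n" by blast
  show "asymptotic x y"
    unfolding asymptotic_def
  proof (rule tendstoI)
    fix e :: real assume "e > 0"
    then obtain m where m: "(1 / 2) ^ m < e"
      using real_arch_pow_inv[of e "1/2"] by auto
    have "dist (shift_dist (shift_pow n x) (shift_pow n y)) 0 < e" if "n \<le> l - int m" for n
    proof -
      have "shift_dist (shift_pow n x) (shift_pow n y) \<le> (1 / 2) ^ m"
        unfolding shift_dist_le_half_power_iff shift_pow_def using that by (auto intro!: l)
      moreover have "0 \<le> shift_dist (shift_pow n x) (shift_pow n y)"
        by (simp add: shift_dist_def)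
      ultimately show ?thesis using m by simp
    qed
    then show "eventually (\<lambda>n. dist (shift_dist (shift_pow n x) (shift_pow n y)) 0 < e) at_bot"
      by (auto simp: eventually_at_bot_linorder)
  qed
qed

lemma equiv_asymptotic_rel: "equiv X (asymptotic_rel X)"
proof (rule equivI)
  show "asymptotic_rel X \<subseteq> X \<times> X" by (auto simp: asymptotic_rel_def)
  show "refl_on X (asymptotic_rel X)"
    by (auto simp: refl_on_def asymptotic_rel_def asymptotic_iff intro!: exI[of _ 0])
  show "sym (asymptotic_rel X)"
  proof (rule symI)
    fix x y assume "(x, y) \<in> asymptotic_rel X"
    then obtain k l where "x \<in> X" "y \<in> X" and *: "\<And>n. n < l \<Longrightarrow> x n = y (n + k)"
      by (auto simp: asymptotic_rel_def asymptotic_iff shift_pow_def)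
    moreover have "\<forall>n<l + k. y n = x (n + - k)" using *[of "_ - k"] by simp
    ultimately show "(y, x) \<in> asymptotic_rel X"
      unfolding asymptotic_rel_def asymptotic_iff shift_pow_def by blast
  qed
  show "trans (asymptotic_rel X)"
  proof (rule transI)
    fix x y z assume "(x, y) \<in> asymptotic_rel X" "(y, z) \<in> asymptotic_rel X"
    then obtain k l k' l' where "x \<in> X" "z \<in> X" and
      *: "\<And>n. n < l \<Longrightarrow> x n = y (n + k)" "\<And>n. n < l' \<Longrightarrow> y n = z (n + k')"
      by (auto simp: asymptotic_rel_def asymptotic_iff shift_pow_def)
    moreover have "\<forall>n<min l (l' - k). x n = z (n + (k + k'))"
      using * by (simp add: add.assoc[symmetric])
    ultimately show "(x, z) \<in> asymptotic_rel X"
      unfolding asymptotic_rel_def asymptotic_iff shift_pow_def by blast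
  qed
qed

end

theory Submission
  imports Defs
begin

text \<open>
  Why only polynomially many classes. Choose levels \<open>n\<close> with at most \<open>K\<close> letters. Every point of the
  subshift is a bi-infinite concatenation of the \<open>K\<close> words \<open>block \<tau> 0 n [a]\<close>, and these words get
  arbitrarily long. Along a suitable subsequence of levels the neighbourhood of the place where
  the \<open>i\<close>-th word is followed by the \<open>i'\<close>-th converges to a two-sided sequence, so up to a shift only
  \<open>K\<^sup>2\<close> local pictures occur at such places. Let \<open>V\<close> contain one sequence from each of
  their orbits. A point has a mark of type \<open>y \<in> V\<close> at a position if it agrees with \<open>y\<close> on a window
  of a fixed large radius \<open>A\<close> there. If \<open>A\<close> is large, two marks at a short distance in one point have
  the same type \<open>y\<close>, and the distance is zero or a period of \<open>y\<close>. Cutting the points at marks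
  instead of at the ends of words therefore gives canonical cuts, and turns the points into
  two-sided paths in a finite graph with vertex set \<open>V\<close> and at most \<open>K\<^sup>3\<close> edges, one for
  each triple of consecutive words (\<open>junction_graph\<close>); each periodic vertex carries in addition a
  loop reading one period, which is not counted.

  Among all such graphs with at most \<open>K\<^sup>3\<close> edges, take one of least total length of labels.
  Two operations change a graph without losing a point. Folding (\<open>fold_edge\<close>) removes from the label
  of an edge the label of another edge with the same start; the number of edges does not grow, and the
  total becomes smaller.
  Cutting (\<open>cut_edge\<close>) divides an edge at a mark inside it; it adds at most one edge and does not
  increase the total. If two different paths with the same ends read the same word, then folding at the
  first difference again and again must make an edge disappear, since a fold acts as an injective
  substitution on paths (\<open>ambiguity_lowers_card\<close>).

  Now let two points agree on the negative positions and differ at \<open>0\<close>. If their paths had no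
  common mark far to the left, then by the pigeonhole principle two marks of the second path would
  lie at the same offset inside the same edge of the first. Cutting the edge at this offset creates
  an ambiguity between these two places, and removing it gives back the additional edge with a
  smaller total: impossible (\<open>no_repeated_offset\<close>, \<open>common_mark\<close>). After the last common mark the
  paths use different edges \<open>a\<close> and \<open>b\<close>. Neither can end far to the left of \<open>0\<close>, because they could then
  be folded (\<open>branching_exists\<close>). Hence \<open>0\<close> is the first position at which the continuations of
  \<open>a\<close> and \<open>b\<close> differ, and \<open>(a, b)\<close> determines the common past on a window
  (\<open>branching_unique\<close>) that may be chosen long enough to separate any given finite set of classes.
  So there are at most \<open>(K\<^sup>3 + K\<^sup>2)\<^sup>2\<close> classes, which is at most \<open>4 * K ^ 6\<close>.
\<close>

section \<open>Words read in two-sided sequences, and paths of labelled edges\<close>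

definition spells :: "(int \<Rightarrow> 'a) \<Rightarrow> int \<Rightarrow> 'a list \<Rightarrow> bool" where
  "spells x k w \<longleftrightarrow> (\<forall>i<length w. x (k + int i) = w ! i)"

lemma spells_Nil [simp]: "spells x k []"
  by (simp add: spells_def)

lemma spells_append:
  "spells x k (u @ v) \<longleftrightarrow> spells x k u \<and> spells x (k + int (length u)) v"
proof
  assume *: "spells x k (u @ v)"
  have "x (k + int i) = u ! i" if "i < length u" for i
    using *[unfolded spells_def, rule_format, of i] that by (simp add: nth_append)
  moreover have "x (k + int (length u) + int i) = v ! i" if "i < length v" for i
    using *[unfolded spells_def, rule_format, of "length u + i"] that
    by (simp add: nth_append add.assoc)
  ultimately show "spells x k u \<and> spells x (k + int (length u)) v"
    by (simp add: spells_def)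
next
  assume *: "spells x k u \<and> spells x (k + int (length u)) v"
  show "spells x k (u @ v)"
    unfolding spells_def
  proof (intro allI impI)
    fix i assume "i < length (u @ v)"
    then show "x (k + int i) = (u @ v) ! i"
      using * unfolding spells_def
      by (cases "i < length u")
        (auto simp: nth_append add.assoc dest!: spec[of _ "i - length u"])
  qed
qed

lemma spells_cong:
  assumes "\<And>i. k \<le> i \<Longrightarrow> i < k + int (length w) \<Longrightarrow> x i = y i"
  shows "spells x k w \<longleftrightarrow> spells y k w"
  using assms by (simp add: spells_def)

lemma spells_unique:
  "spells x k u \<Longrightarrow> spells x k v \<Longrightarrow> length u = length v \<Longrightarrow> u = v"
  by (auto simp: spells_def intro!: nth_equalityI)

lemma spells_prefix:
  assumes "spells x k u" "spells x k v" "length u \<le> length v"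
  obtains g where "v = u @ g"
proof -
  have "spells x k (take (length u) v)"
    using assms(2) spells_append[of x k "take (length u) v" "drop (length u) v"] by simp
  then have "take (length u) v = u"
    using assms(1,3) by (intro spells_unique[of x k]) auto
  then show ?thesis using that[of "drop (length u) v"] by (metis append_take_drop_id)
qed

lemma spells_at:
  assumes "spells x k w" "k \<le> i" "i < k + int (length w)"
  shows "x i = w ! nat (i - k)"
  using assms(1)[unfolded spells_def, rule_format, of "nat (i - k)"] assms(2,3) by simp

definition periodic :: "(int \<Rightarrow> 'a) \<Rightarrow> nat \<Rightarrow> bool" where
  "periodic y p \<longleftrightarrow> 0 < p \<and> (\<forall>i. y (i + int p) = y i)"

definition min_period :: "(int \<Rightarrow> 'a) \<Rightarrow> nat" where
  "min_period y = (LEAST p. periodic y p)"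

lemma periodic_min_period: "periodic y p \<Longrightarrow> periodic y (min_period y)"
  unfolding min_period_def by (rule LeastI)

lemma min_period_le: "periodic y p \<Longrightarrow> min_period y \<le> p"
  unfolding min_period_def by (rule Least_le)

lemma periodic_diff:
  assumes "periodic y p" "periodic y q" "p < q"
  shows "periodic y (q - p)"
  unfolding periodic_def
proof (intro conjI allI)
  fix i
  have "y (i + int (q - p)) = y (i + int (q - p) + int p)"
    using assms(1) by (simp add: periodic_def)
  also have "i + int (q - p) + int p = i + int q" using assms(3) by simp
  also have "y (i + int q) = y i" using assms(2) by (simp add: periodic_def)
  finally show "y (i + int (q - p)) = y i" .
qed (use assms in simp)

type_synonym 'a edge = "(int \<Rightarrow> 'a) \<times> 'a list \<times> (int \<Rightarrow> 'a)"

abbreviation src :: "'a edge \<Rightarrow> (int \<Rightarrow> 'a)" where "src e \<equiv> fst e"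
abbreviation lab :: "'a edge \<Rightarrow> 'a list" where "lab e \<equiv> fst (snd e)"
abbreviation tgt :: "'a edge \<Rightarrow> (int \<Rightarrow> 'a)" where "tgt e \<equiv> snd (snd e)"

definition word :: "'a edge list \<Rightarrow> 'a list" where
  "word p = concat (map lab p)"

lemma word_simps [simp]:
  "word [] = []" "word (e # p) = lab e @ word p" "word (p @ q) = word p @ word q"
  by (simp_all add: word_def)

fun chain :: "(int \<Rightarrow> 'a) \<Rightarrow> 'a edge list \<Rightarrow> (int \<Rightarrow> 'a) \<Rightarrow> bool" where
  "chain y [] z \<longleftrightarrow> y = z"
| "chain y (e # p) z \<longleftrightarrow> src e = y \<and> chain (tgt e) p z"

lemma chain_append: "chain y (p @ q) z \<longleftrightarrow> (\<exists>m. chain y p m \<and> chain m q z)"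
  by (induction p arbitrary: y) auto

definition loop :: "(int \<Rightarrow> 'a) \<Rightarrow> 'a edge" where
  "loop y = (y, map (\<lambda>i. y (int i)) [0..<min_period y], y)"

definition total_length :: "'a edge set \<Rightarrow> nat" where
  "total_length E = (\<Sum>e\<in>E. length (lab e))"

definition subst :: "('a edge \<Rightarrow> 'a edge list) \<Rightarrow> 'a edge list \<Rightarrow> 'a edge list" where
  "subst s p = concat (map s p)"

lemma subst_simps [simp]:
  "subst s [] = []" "subst s (e # p) = s e @ subst s p" "subst s (p @ q) = subst s p @ subst s q"
  by (simp_all add: subst_def)

lemma subst_path:
  assumes "\<And>e. e \<in> S \<Longrightarrow> chain (src e) (s e) (tgt e) \<and> set (s e) \<subseteq> T \<and> word (s e) = lab e"
    and "set p \<subseteq> S" "chain y p z"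
  shows "chain y (subst s p) z" "set (subst s p) \<subseteq> T" "word (subst s p) = word p"
proof -
  have "chain y (subst s p) z \<and> set (subst s p) \<subseteq> T \<and> word (subst s p) = word p"
    using assms(2,3)
  proof (induction p arbitrary: y)
    case (Cons e p)
    then show ?case using assms(1)[of e] by (auto simp: chain_append)
  qed simp
  then show "chain y (subst s p) z" "set (subst s p) \<subseteq> T" "word (subst s p) = word p" by auto
qed

text \<open>A fold rewrites paths by replacing \<open>b\<close> with \<open>a\<close> followed by a new edge \<open>g\<close>. The new edge occurs only
  directly after an inserted \<open>a\<close>, so the old path can be recovered.\<close>

lemma subst_split_inj:
  assumes "subst (\<lambda>e. if e = b then [a, g] else [e]) p = subst (\<lambda>e. if e = b then [a, g] else [e]) q"
    and "g \<notin> set p" "g \<notin> set q" "a \<noteq> g"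
  shows "p = q"
  using assms(1-3)
proof (induction p arbitrary: q)
  case Nil
  then show ?case by (cases q) (auto split: if_splits)
next
  case (Cons e p)
  let ?s = "subst (\<lambda>e. if e = b then [a, g] else [e])"
  obtain f q' where q: "q = f # q'" using Cons.prems by (cases q) (auto split: if_splits)
  have no_g: "?s r \<noteq> g # t" if "g \<notin> set r" for r t
    using that assms(4) by (cases r) (auto split: if_splits)
  have "e = f"
    using Cons.prems q no_g[of p] no_g[of p, THEN not_sym] no_g[of q'] no_g[of q', THEN not_sym]
    by (auto split: if_splits)
  moreover have "?s p = ?s q'" using Cons.prems(1) q \<open>e = f\<close> by (auto split: if_splits)
  ultimately show ?case using Cons q by auto
qed

lemma first_difference:
  assumes "\<And>r. p \<noteq> q @ r" "\<And>r. q \<noteq> p @ r"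
  obtains u a b p' q' where "p = u @ a # p'" "q = u @ b # q'" "a \<noteq> b"
  using assms
proof (induction p arbitrary: q thesis)
  case Nil
  from Nil.prems(3)[of q] show ?case by simp
next
  case (Cons e p)
  obtain f q' where q: "q = f # q'" using Cons.prems(2)[of "e # p"] by (cases q) auto
  show ?case
  proof (cases "e = f")
    case False
    then show ?thesis using Cons.prems(1)[of "[]"] q by auto
  next
    case True
    obtain u a b p1 q1 where "p = u @ a # p1" "q' = u @ b # q1" "a \<noteq> b"
      by (rule Cons.IH[of q']) (use Cons.prems(2,3) q True in auto)
    then show ?thesis using Cons.prems(1)[of "f # u"] q True by auto
  qed
qed

lemma chain_unique: "chain y p m \<Longrightarrow> chain y p n \<Longrightarrow> m = n"
  by (induction p arbitrary: y) auto

section \<open>Marks and coherent graphs\<close>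

text \<open>The vertices \<open>V\<close> of the graphs are two-sided sequences. \<open>A\<close> is the radius of the window that a mark
  controls; edges have length at least \<open>D\<close>, and shorter distances between marks are governed by
  \<open>rigid\<close>: short of \<open>D\<close>, sequences of \<open>V\<close> can only match on the window by a period of one sequence.\<close>

locale rigid_types =
  fixes V :: "(int \<Rightarrow> 'a) set" and D A :: nat
  assumes finite_V: "finite V"
    and period_less: "y \<in> V \<Longrightarrow> periodic y p \<Longrightarrow> min_period y < D"
    and D_pos: "0 < D" and D_le_A: "D \<le> A"
    and rigid: "y \<in> V \<Longrightarrow> y' \<in> V \<Longrightarrow> d < D \<Longrightarrow>
      (\<And>i. - int A \<le> i \<Longrightarrow> i < int A - int d \<Longrightarrow> y' i = y (i + int d)) \<Longrightarrow>
      y' = y \<and> (d = 0 \<or> periodic y d)"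
begin

text \<open>The two halves of a mark are kept apart because they travel in opposite directions along a path:
  the left half is inherited from the preceding vertex, the right half from the following one.\<close>

definition lmark :: "(int \<Rightarrow> 'a) \<Rightarrow> int \<Rightarrow> (int \<Rightarrow> 'a) \<Rightarrow> bool" where
  "lmark x k y \<longleftrightarrow> (\<forall>i. - int A \<le> i \<longrightarrow> i < 0 \<longrightarrow> x (k + i) = y i)"

definition rmark :: "(int \<Rightarrow> 'a) \<Rightarrow> int \<Rightarrow> (int \<Rightarrow> 'a) \<Rightarrow> bool" where
  "rmark x k y \<longleftrightarrow> (\<forall>i. 0 \<le> i \<longrightarrow> i < int A \<longrightarrow> x (k + i) = y i)"

definition mark :: "(int \<Rightarrow> 'a) \<Rightarrow> int \<Rightarrow> (int \<Rightarrow> 'a) \<Rightarrow> bool" where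
  "mark x k y \<longleftrightarrow> lmark x k y \<and> rmark x k y"

lemma markD: "mark x k y \<Longrightarrow> - int A \<le> i \<Longrightarrow> i < int A \<Longrightarrow> x (k + i) = y i"
  unfolding mark_def lmark_def rmark_def by (cases "i < 0") auto

lemma mark_cong:
  assumes "mark x k y" "\<And>i. k - int A \<le> i \<Longrightarrow> i < k + int A \<Longrightarrow> x i = x' i"
  shows "mark x' k y"
proof -
  have "x' (k + i) = y i" if "- int A \<le> i" "i < int A" for i
    using markD[OF assms(1) that] assms(2)[of "k + i"] that by simp
  then show ?thesis by (simp add: mark_def lmark_def rmark_def)
qed

text \<open>The label of a coherent edge, flanked by the halves of its end vertices, shows both
  complete marks. This property of single edges is what makes every vertex of a path visible as a
  mark of the point that the path reads (\<open>parse_append\<close>).\<close>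

definition coherent :: "'a edge \<Rightarrow> bool" where
  "coherent e \<longleftrightarrow> (\<exists>x k. mark x k (src e) \<and> spells x k (lab e) \<and>
                       mark x (k + int (length (lab e))) (tgt e))"

lemma lmark_step:
  assumes "coherent e" "lmark x k (src e)" "spells x k (lab e)"
  shows "lmark x (k + int (length (lab e))) (tgt e)"
  unfolding lmark_def
proof (intro allI impI)
  fix i :: int assume i: "- int A \<le> i" "i < 0"
  let ?n = "int (length (lab e))"
  obtain t l where t: "mark t l (src e)" "spells t l (lab e)" "mark t (l + ?n) (tgt e)"
    using assms(1) by (auto simp: coherent_def)
  have "x (k + (?n + i)) = t (l + (?n + i))"
  proof (cases "?n + i < 0")
    case True
    then have "x (k + (?n + i)) = src e (?n + i)" using assms(2) i by (auto simp: lmark_def)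
    then show ?thesis using markD[OF t(1), of "?n + i"] True i by simp
  next
    case False
    define j where "j = nat (?n + i)"
    have "j < length (lab e)" "?n + i = int j" using False i by (auto simp: j_def)
    then show ?thesis using assms(3) t(2) by (simp add: spells_def)
  qed
  also have "\<dots> = tgt e i" using markD[OF t(3), of i] i by (simp add: add.assoc)
  finally show "x (k + ?n + i) = tgt e i" by (simp add: add.assoc)
qed

lemma rmark_step:
  assumes "coherent e" "rmark x (k + int (length (lab e))) (tgt e)" "spells x k (lab e)"
  shows "rmark x k (src e)"
  unfolding rmark_def
proof (intro allI impI)
  fix i :: int assume i: "0 \<le> i" "i < int A"
  let ?n = "int (length (lab e))"
  obtain t l where t: "mark t l (src e)" "spells t l (lab e)" "mark t (l + ?n) (tgt e)"
    using assms(1) by (auto simp: coherent_def)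
  have "x (k + i) = t (l + i)"
  proof (cases "i < ?n")
    case True
    define j where "j = nat i"
    have "j < length (lab e)" "i = int j" using True i by (auto simp: j_def)
    then show ?thesis using assms(3) t(2) by (simp add: spells_def)
  next
    case False
    then have "x (k + ?n + (i - ?n)) = tgt e (i - ?n)" using assms(2) i
      unfolding rmark_def by (meson diff_ge_0_iff_ge diff_less_eq le_less_trans less_add_same_cancel1
          linorder_not_le of_nat_0_le_iff le_add_same_cancel1 order_less_le_trans)
    then show ?thesis using markD[OF t(3), of "i - ?n"] False i by simp
  qed
  also have "\<dots> = src e i" using markD[OF t(1), of i] i by simp
  finally show "x (k + i) = src e i" .
qed

definition loops :: "'a edge set" where
  "loops = {loop y |y. y \<in> V \<and> (\<exists>p. periodic y p)}"

lemma loopsE: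
  assumes "e \<in> loops"
  obtains y where "y \<in> V" "e = loop y" "periodic y (min_period y)" "min_period y < D"
  using assms periodic_min_period period_less unfolding loops_def by blast

lemma loop_facts:
  assumes "e \<in> loops"
  shows "src e \<in> V" "tgt e \<in> V" "coherent e" "0 < length (lab e)" "length (lab e) < D"
proof -
  obtain y where y: "y \<in> V" "e = loop y" "periodic y (min_period y)" "min_period y < D"
    using assms by (rule loopsE)
  show "src e \<in> V" "tgt e \<in> V" "0 < length (lab e)" "length (lab e) < D"
    using y by (auto simp: loop_def periodic_def)
  have "mark y 0 y" by (simp add: mark_def lmark_def rmark_def)
  moreover have "mark y (int (min_period y)) y"
    using y(3) by (simp add: mark_def lmark_def rmark_def periodic_def add.commute)
  moreover have "spells y 0 (lab e)" using y(2) by (simp add: spells_def loop_def)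
  ultimately show "coherent e"
    unfolding coherent_def using y(2) by (intro exI[of _ y] exI[of _ 0]) (simp add: loop_def)
qed

text \<open>The periods of \<open>y\<close> are the multiples of its least period: subtract the least period repeatedly.\<close>

lemma loop_path:
  assumes "y \<in> V" "d = 0 \<or> periodic y d" "length g = d" "spells y 0 g"
  shows "\<exists>q. chain y q y \<and> set q \<subseteq> loops \<and> word q = g"
  using assms
proof (induction d arbitrary: g rule: less_induct)
  case (less d)
  show ?case
  proof (cases "d = 0")
    case True
    then show ?thesis using less.prems by (intro exI[of _ "[]"]) auto
  next
    case False
    define m where "m = min_period y"
    have d: "periodic y d" using False less.prems by auto
    have m: "periodic y m" "m \<le> d" "0 < m"
      using periodic_min_period[OF d] min_period_le[OF d] by (auto simp: m_def periodic_def)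
    have sp: "spells y 0 (take m g)" "spells y (int m) (drop m g)"
      using less.prems(3,4) m(2) spells_append[of y 0 "take m g" "drop m g"] by auto
    have "spells y 0 (drop m g)"
      using sp(2) m(1) by (simp add: spells_def periodic_def add.commute)
    moreover have "d - m = 0 \<or> periodic y (d - m)"
      using periodic_diff[OF m(1) d] m(2) by (cases "m = d") auto
    ultimately obtain q where q: "chain y q y" "set q \<subseteq> loops" "word q = drop m g"
      using less.IH[of "d - m" "drop m g"] less.prems m by auto
    have "lab (loop y) = take m g"
      using sp(1) less.prems(3) m(2)
      by (intro spells_unique[of y 0]) (auto simp: loop_def m_def spells_def)
    moreover have "loop y \<in> loops" using less.prems(1) d by (auto simp: loops_def)
    ultimately show ?thesis using q
      by (intro exI[of _ "loop y # q"]) (auto simp: loop_def)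
  qed
qed

definition valid :: "'a edge set \<Rightarrow> bool" where
  "valid E \<longleftrightarrow> finite E \<and> (\<forall>e\<in>E. src e \<in> V \<and> tgt e \<in> V \<and> D \<le> length (lab e) \<and> coherent e)"

text \<open>Every edge of \<open>E\<close> can be replaced by a path of \<open>E'\<close> with the same ends and the same word, so
  whatever is read in \<open>E\<close> is read in \<open>E'\<close> as well.\<close>

definition refines :: "'a edge set \<Rightarrow> 'a edge set \<Rightarrow> bool" where
  "refines E E' \<longleftrightarrow> (\<exists>s. \<forall>e\<in>E \<union> loops.
     chain (src e) (s e) (tgt e) \<and> set (s e) \<subseteq> E' \<union> loops \<and> word (s e) = lab e)"

lemma refines_trans:
  assumes "refines E E'" "refines E' E''"
  shows "refines E E''"
proof -
  obtain s where s: "\<forall>e\<in>E \<union> loops. chain (src e) (s e) (tgt e) \<and>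
      set (s e) \<subseteq> E' \<union> loops \<and> word (s e) = lab e"
    using assms(1) by (auto simp: refines_def)
  obtain t where t: "\<forall>e\<in>E' \<union> loops. chain (src e) (t e) (tgt e) \<and>
      set (t e) \<subseteq> E'' \<union> loops \<and> word (t e) = lab e"
    using assms(2) by (auto simp: refines_def)
  have "chain (src e) (subst t (s e)) (tgt e) \<and> set (subst t (s e)) \<subseteq> E'' \<union> loops \<and>
      word (subst t (s e)) = lab e" if "e \<in> E \<union> loops" for e
    using subst_path[of "E' \<union> loops" t "E'' \<union> loops" "s e" "src e" "tgt e"] s t that by auto
  then show ?thesis unfolding refines_def by (intro exI[of _ "\<lambda>e. subst t (s e)"]) blast
qed

definition parse :: "'a edge set \<Rightarrow> (int \<Rightarrow> 'a) \<Rightarrow> int \<Rightarrow> 'a edge list \<Rightarrow>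
    (int \<Rightarrow> 'a) \<Rightarrow> (int \<Rightarrow> 'a) \<Rightarrow> bool" where
  "parse E x c p y z \<longleftrightarrow> set p \<subseteq> E \<union> loops \<and> chain y p z \<and> y \<in> V \<and> spells x c (word p) \<and>
     lmark x c y \<and> rmark x (c + int (length (word p))) z"

lemma edge_facts:
  assumes "valid E" "e \<in> E \<union> loops"
  shows "src e \<in> V" "tgt e \<in> V" "coherent e" "lab e \<noteq> []"
  using assms loop_facts[of e] D_pos by (auto simp: valid_def)

lemma lmark_at_end:
  assumes "valid E" "set p \<subseteq> E \<union> loops" "chain y p z" "y \<in> V" "spells x c (word p)" "lmark x c y"
  shows "lmark x (c + int (length (word p))) z \<and> z \<in> V"
  using assms(2-)
proof (induction p arbitrary: c y)
  case (Cons e p)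
  have "lmark x (c + int (length (lab e))) (tgt e)"
    using Cons.prems edge_facts[OF assms(1)] by (intro lmark_step) (auto simp: spells_append)
  then show ?case using Cons edge_facts[OF assms(1), of e]
    by (force simp: spells_append add.assoc)
qed simp

lemma rmark_at_start:
  assumes "valid E" "set p \<subseteq> E \<union> loops" "chain y p z" "spells x c (word p)"
    "rmark x (c + int (length (word p))) z"
  shows "rmark x c y"
  using assms(2-)
proof (induction p arbitrary: c y)
  case (Cons e p)
  have "rmark x (c + int (length (lab e))) (tgt e)"
    using Cons by (force simp: spells_append add.assoc)
  then show ?case
    using rmark_step[of e x c] Cons.prems edge_facts[OF assms(1), of e]
    by (auto simp: spells_append)
qed simp

lemma parse_append:
  assumes "valid E" "parse E x c (p @ q) y z"
  obtains m where "m \<in> V" "mark x (c + int (length (word p))) m"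
    "parse E x c p y m" "parse E x (c + int (length (word p))) q m z"
proof -
  from assms(2) obtain m where m: "chain y p m" "chain m q z"
    by (auto simp: parse_def chain_append)
  let ?k = "c + int (length (word p))"
  have l: "lmark x ?k m \<and> m \<in> V"
    using assms m by (intro lmark_at_end[of E p y]) (auto simp: parse_def spells_append)
  have r: "rmark x ?k m"
    using assms m by (intro rmark_at_start[of E q m z]) (auto simp: parse_def spells_append add.assoc)
  show ?thesis
    by (rule that[of m]) (use assms(2) l r m in
      \<open>auto simp: parse_def mark_def spells_append add.assoc\<close>)
qed

lemma parse_refines:
  assumes "refines E E'" "parse E x c p y z"
  obtains q where "parse E' x c q y z" "word q = word p"
proof -
  obtain s where s: "\<forall>e\<in>E \<union> loops. chain (src e) (s e) (tgt e) \<and>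
      set (s e) \<subseteq> E' \<union> loops \<and> word (s e) = lab e"
    using assms(1) by (auto simp: refines_def)
  have p: "set p \<subseteq> E \<union> loops" "chain y p z" using assms(2) by (auto simp: parse_def)
  note q = subst_path[OF s[rule_format] p]
  show ?thesis
    by (rule that[of "subst s p"]) (use assms(2) q in \<open>auto simp: parse_def\<close>)
qed

lemma word_pos:
  assumes "valid E" "set p \<subseteq> E \<union> loops" "p \<noteq> []"
  shows "0 < length (word p)"
  using assms edge_facts(4)[OF assms(1)] by (cases p) auto

section \<open>Folding and cutting edges\<close>

lemma coherentI:
  "mark x k y \<Longrightarrow> spells x k g \<Longrightarrow> mark x (k + int (length g)) z \<Longrightarrow> coherent (y, g, z)"
  by (auto simp: coherent_def)

text \<open>The edge needed for reading a coherent word \<open>g\<close> from \<open>y\<close> to \<open>z\<close>. None is needed for a short word: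
  by rigidity it is a power of the period of \<open>y = z\<close> and can be read along the loop at \<open>y\<close>.\<close>

definition piece :: "(int \<Rightarrow> 'a) \<Rightarrow> 'a list \<Rightarrow> (int \<Rightarrow> 'a) \<Rightarrow> 'a edge set" where
  "piece y g z = (if length g < D then {} else {(y, g, z)})"

lemma piece_path:
  assumes "y \<in> V" "z \<in> V" "coherent (y, g, z)"
  obtains q where "chain y q z" "set q \<subseteq> piece y g z \<union> loops" "word q = g"
proof (cases "length g < D")
  case False
  then show ?thesis by (intro that[of "[(y, g, z)]"]) (auto simp: piece_def)
next
  case True
  obtain x k where x: "mark x k y" "spells x k g" "mark x (k + int (length g)) z"
    using assms(3) by (auto simp: coherent_def)
  have "z i = y (i + int (length g))" if "- int A \<le> i" "i < int A - int (length g)" for i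
  proof -
    have "z i = x (k + int (length g) + i)" using markD[OF x(3), of i] that by simp
    also have "\<dots> = x (k + (i + int (length g)))" by (simp add: add_ac)
    also have "\<dots> = y (i + int (length g))" using that by (intro markD[OF x(1)]) auto
    finally show ?thesis .
  qed
  then have yz: "z = y" "length g = 0 \<or> periodic y (length g)"
    using rigid[OF assms(1,2) True] by auto
  have "spells y 0 g"
    unfolding spells_def
  proof (intro allI impI)
    fix i assume i: "i < length g"
    then have "x (k + int i) = y (int i)" using True D_le_A by (intro markD[OF x(1)]) auto
    then show "y (0 + int i) = g ! i" using x(2) i by (simp add: spells_def)
  qed
  then obtain q where "chain y q y" "set q \<subseteq> loops" "word q = g"
    using loop_path[OF assms(1) yz(2) refl] by blast
  then show ?thesis using yz(1) by (intro that[of q]) auto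
qed

lemma valid_piece: "y \<in> V \<Longrightarrow> z \<in> V \<Longrightarrow> coherent (y, g, z) \<Longrightarrow> valid (piece y g z)"
  by (auto simp: valid_def piece_def)

lemma valid_Un: "valid E \<Longrightarrow> valid E' \<Longrightarrow> valid (E \<union> E')"
  by (auto simp: valid_def)

lemma valid_Diff: "valid E \<Longrightarrow> valid (E - S)"
  by (auto simp: valid_def)

lemma refines_replace:
  assumes "chain (src e) q (tgt e)" "set q \<subseteq> (E - {e}) \<union> S \<union> loops" "word q = lab e"
  shows "refines E ((E - {e}) \<union> S)"
  unfolding refines_def
  by (rule exI[of _ "\<lambda>f. if f = e then q else [f]"]) (use assms in auto)

lemma total_length_Un_le: "finite E \<Longrightarrow> finite E' \<Longrightarrow> total_length (E \<union> E') \<le> total_length E + total_length E'"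
  unfolding total_length_def
  using sum.union_inter[of E E' "\<lambda>e. length (lab e)"] by linarith

lemma total_length_remove: "finite E \<Longrightarrow> e \<in> E \<Longrightarrow> total_length E = length (lab e) + total_length (E - {e})"
  unfolding total_length_def by (rule sum.remove)

lemma total_length_piece_le: "total_length (piece y g z) \<le> length g"
  by (simp add: total_length_def piece_def)

lemma valid_length: "valid E \<Longrightarrow> e \<in> E \<Longrightarrow> D \<le> length (lab e)"
  by (auto simp: valid_def)

text \<open>Replacing \<open>b\<close> by the remainder \<open>g\<close>. The long one of two distinct edges with the same start cannot be a
  loop, as a vertex has only one loop and the labels of loops are shorter than \<open>D\<close>. The number of
  edges drops unless the remainder is a new edge.\<close>

lemma fold_edge:
  assumes E: "valid E" and ab: "a \<in> E \<union> loops" "b \<in> E \<union> loops" "a \<noteq> b" "src a = src b"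
    and g: "lab b = lab a @ g" "coherent (tgt a, g, tgt b)"
  defines "E' \<equiv> (E - {b}) \<union> piece (tgt a) g (tgt b)"
  shows "b \<in> E" "valid E'" "refines E E'" "total_length E' < total_length E" "card E' \<le> card E"
    "length g < D \<or> (tgt a, g, tgt b) \<in> E \<Longrightarrow> card E' < card E"
proof -
  have fin: "finite E" using E by (auto simp: valid_def)
  have inV: "tgt a \<in> V" "tgt b \<in> V" using edge_facts[OF E] ab by auto
  have la: "0 < length (lab a)" using edge_facts(4)[OF E ab(1)] by simp
  show b: "b \<in> E"
  proof (rule ccontr)
    assume "b \<notin> E"
    then have "b \<in> loops" using ab by auto
    then have "length (lab a) < D" using g loop_facts(5)[of b] by simp
    then have "a \<in> loops" using ab(1) valid_length[OF E, of a] by auto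
    with \<open>b \<in> loops\<close> ab(3,4) show False by (auto simp: loops_def loop_def)
  qed
  show "valid E'"
    unfolding E'_def using E g inV by (intro valid_Un valid_Diff valid_piece) auto
  obtain q where q: "chain (tgt a) q (tgt b)" "set q \<subseteq> piece (tgt a) g (tgt b) \<union> loops" "word q = g"
    by (rule piece_path[OF inV g(2)])
  show "refines E E'"
    unfolding E'_def by (rule refines_replace[of _ "a # q"]) (use q ab g in auto)
  have fp: "finite (piece (tgt a) g (tgt b))" by (simp add: piece_def)
  have "total_length E' \<le> total_length (E - {b}) + length g"
    unfolding E'_def using total_length_Un_le[of "E - {b}"] fin fp total_length_piece_le[of "tgt a" g "tgt b"]
    by (meson add_left_mono finite_Diff order_trans)
  then show "total_length E' < total_length E"
    using total_length_remove[OF fin b] arg_cong[OF g(1), of length] la by (simp del: length_0_conv length_greater_0_conv)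
  have cb: "card (E - {b}) + 1 = card E" using b fin by (metis Suc_eq_plus1 card_Suc_Diff1)
  have "card (piece (tgt a) g (tgt b)) \<le> 1" by (simp add: piece_def)
  then show "card E' \<le> card E"
    unfolding E'_def using card_Un_le[of "E - {b}" "piece (tgt a) g (tgt b)"] cb by linarith
  show "card E' < card E" if "length g < D \<or> (tgt a, g, tgt b) \<in> E"
  proof -
    have "(tgt a, g, tgt b) \<noteq> b" using g(1) la by (cases b) auto
    then have "E' = E - {b}" unfolding E'_def piece_def using that by auto
    then show ?thesis using cb by simp
  qed
qed

lemma parse_junction:
  assumes "valid E" "parse E x c (u @ a # p) y z"
  shows "mark x (c + int (length (word u))) (src a)"
    "spells x (c + int (length (word u))) (lab a)"
    "mark x (c + int (length (word u)) + int (length (lab a))) (tgt a)"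
    "a \<in> E \<union> loops" "chain y u (src a)" "src a \<in> V"
    "parse E x (c + int (length (word u))) (a # p) (src a) z"
proof -
  obtain m where m: "m \<in> V" "mark x (c + int (length (word u))) m"
    "parse E x c u y m" "parse E x (c + int (length (word u))) ([a] @ p) m z"
    using parse_append[OF assms, of thesis] by auto
  obtain n where n: "mark x (c + int (length (word u)) + int (length (word [a]))) n"
    "parse E x (c + int (length (word u))) [a] m n"
    using parse_append[OF assms(1) m(4), of thesis] by auto
  have "m = src a" "n = tgt a" using n(2) by (auto simp: parse_def)
  then show "mark x (c + int (length (word u))) (src a)"
    "spells x (c + int (length (word u))) (lab a)"
    "mark x (c + int (length (word u)) + int (length (lab a))) (tgt a)"
    "a \<in> E \<union> loops" "chain y u (src a)" "src a \<in> V"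
    "parse E x (c + int (length (word u))) (a # p) (src a) z"
    using m n by (auto simp: parse_def)
qed

lemma overlap_coherent:
  assumes "spells x k (lab a)" "spells x k (lab b)" "length (lab a) \<le> length (lab b)"
    "mark x (k + int (length (lab a))) y" "mark x (k + int (length (lab b))) z"
  obtains g where "lab b = lab a @ g" "coherent (y, g, z)"
proof -
  obtain g where g: "lab b = lab a @ g" using spells_prefix[OF assms(1,2,3)] .
  have "coherent (y, g, z)"
    using assms(2,4,5) g by (intro coherentI) (auto simp: spells_append add.assoc)
  with g show ?thesis using that by blast
qed

text \<open>The point that carries the word of the path between the left half of \<open>y\<close> and the right half of \<open>z\<close>
  is read by every path with the same ends and the same word. Thus facts about marks in
  points apply to abstract paths.\<close>

lemma path_read_in_point:
  assumes "set p \<subseteq> E \<union> loops" "chain y p z" "y \<in> V"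
  shows "\<exists>x. \<forall>q. set q \<subseteq> E \<union> loops \<longrightarrow> chain y q z \<longrightarrow> word q = word p \<longrightarrow> parse E x 0 q y z"
proof -
  define n where "n = int (length (word p))"
  \<comment> \<open>left half of \<open>y\<close>, the word, right half of \<open>z\<close>\<close>
  define x where "x i = (if i < 0 then y i else if i < n then word p ! nat i else z (i - n))" for i
  have "lmark x 0 y" "rmark x n z" "spells x 0 (word p)"
    by (auto simp: lmark_def rmark_def spells_def x_def n_def)
  then show ?thesis using assms by (intro exI[of _ x]) (auto simp: parse_def n_def)
qed

lemma equal_words_not_extension:
  assumes "valid E" "set p \<subseteq> E \<union> loops" "word p = word q" "p \<noteq> q"
  shows "p \<noteq> q @ r"
proof
  assume p: "p = q @ r"
  then have "r \<noteq> []" using assms(4) by auto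
  then have "0 < length (word r)" using word_pos[OF assms(1), of r] assms(2) p by auto
  then show False using assms(3) p by simp
qed

text \<open>Fold at the first place where the paths differ. If this does not remove an edge, the rewritten paths
  are still different, by injectivity, and the total length has decreased; so the
  process must stop, and it can only stop by removing an edge.\<close>

lemma ambiguity_lowers_card:
  assumes "valid E" "set p \<subseteq> E \<union> loops" "set q \<subseteq> E \<union> loops" "chain y p z" "chain y q z"
    "y \<in> V" "word p = word q" "p \<noteq> q"
  shows "\<exists>E'. valid E' \<and> refines E E' \<and> card E' < card E \<and> total_length E' < total_length E"
  using assms
proof (induction "total_length E" arbitrary: E p q rule: less_induct)
  case less
  note E = less.prems(1)
  obtain u a b p' q' where pq: "p = u @ a # p'" "q = u @ b # q'" "a \<noteq> b"
    using first_difference[OF equal_words_not_extension[OF E less.prems(2,7,8)]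
        equal_words_not_extension[OF E less.prems(3) less.prems(7,8)[symmetric]]] .
  obtain x where x: "\<And>q. set q \<subseteq> E \<union> loops \<Longrightarrow> chain y q z \<Longrightarrow> word q = word p \<Longrightarrow>
      parse E x 0 q y z"
    using path_read_in_point[OF less.prems(2,4,6)] by blast
  have x: "parse E x 0 p y z" "parse E x 0 q y z"
    using x[OF less.prems(2,4)] x[OF less.prems(3,5)] less.prems(7) by auto
  have step: ?case if pq: "p = u @ a # p'" "q = u @ b # q'" "a \<noteq> b"
    and x: "parse E x 0 p y z" "parse E x 0 q y z" and w: "word p = word q" 
    and le: "length (lab a) \<le> length (lab b)" for p q a b p' q'
  proof -
    note ja = parse_junction[OF E x(1)[unfolded pq(1)]]
    note jb = parse_junction[OF E x(2)[unfolded pq(2)]]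
    obtain g where g: "lab b = lab a @ g" "coherent (tgt a, g, tgt b)"
      using overlap_coherent[OF ja(2) jb(2) le ja(3) jb(3)] .
    have s: "src a = src b" by (rule chain_unique[OF ja(5) jb(5)])
    define E' where "E' = (E - {b}) \<union> piece (tgt a) g (tgt b)"
    note f = fold_edge[OF E ja(4) jb(4) pq(3) s g, folded E'_def]
    define h where "h = (tgt a, g, tgt b)"
    show ?case
    proof (cases "length g < D \<or> h \<in> E")
      case True
      then have "card E' < card E" unfolding h_def by (rule f(6))
      then show ?thesis using f(2-4) by (intro exI[of _ E']) simp
    next
      case False
      have hE: "h \<notin> E \<union> loops" using False loop_facts(5)[of h] by (auto simp: h_def)
      have E': "E' = insert h (E - {b})" using False by (auto simp: E'_def piece_def h_def)
      define s' where "s' = (\<lambda>e. if e = b then [a, h] else [e])"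
      have s': "chain (src e) (s' e) (tgt e) \<and> set (s' e) \<subseteq> E' \<union> loops \<and> word (s' e) = lab e"
        if "e \<in> E \<union> loops" for e
      proof (cases "e = b")
        case True
        have "h \<in> E'" "a \<in> E' \<union> loops" using E' ja(4) pq(3) by auto
        with True s g(1) show ?thesis by (simp add: s'_def h_def)
      next
        case False
        with that E' show ?thesis by (simp add: s'_def)
      qed
      have P: "set p \<subseteq> E \<union> loops" "chain y p z" and Q: "set q \<subseteq> E \<union> loops" "chain y q z"
        using x by (auto simp: parse_def)
      have neq: "subst s' p \<noteq> subst s' q"
      proof
        assume "subst s' p = subst s' q"
        moreover have "h \<notin> set p" "h \<notin> set q" "a \<noteq> h" using P(1) Q(1) hE ja(4) by blast+
        ultimately have "p = q" unfolding s'_def by (rule subst_split_inj)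
        then show False using pq by simp
      qed
      note P' = subst_path[OF s' P] and Q' = subst_path[OF s' Q]
      have "word (subst s' p) = word (subst s' q)" using P'(3) Q'(3) w by simp
      then obtain E'' where "valid E''" "refines E' E''" "card E'' < card E'"
        "total_length E'' < total_length E'"
        using less.hyps[OF f(4,2) P'(2) Q'(2) P'(1) Q'(1) less.prems(6) _ neq] by blast
      then show ?thesis using f(3-5) refines_trans[OF f(3), of E''] by (intro exI[of _ E'']) simp
    qed
  qed
  show ?case
  proof (cases "length (lab a) \<le> length (lab b)")
    case True
    then show ?thesis by (rule step[OF pq x less.prems(7)])
  next
    case False
    then show ?thesis
      by (intro step[OF pq(2,1) pq(3)[symmetric] x(2,1) less.prems(7)[symmetric]]) simp
  qed
qed

text \<open>Of the two parts of \<open>e\<close>, a short one needs no edge at all. So either both parts are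
  long, new and different, or the graph has become smaller.\<close>

lemma cut_edge:
  assumes E: "valid E" and e: "e \<in> E" "lab e = g @ h" "g \<noteq> []" "h \<noteq> []" and m: "m \<in> V"
    and coh: "coherent (src e, g, m)" "coherent (m, h, tgt e)"
  defines "E' \<equiv> (E - {e}) \<union> (piece (src e) g m \<union> piece m h (tgt e))"
  shows "valid E'" "refines E E'" "total_length E' \<le> total_length E" "card E' \<le> Suc (card E)"
    "(card E' \<le> card E \<and> total_length E' < total_length E) \<or>
     (piece (src e) g m = {(src e, g, m)} \<and> piece m h (tgt e) = {(m, h, tgt e)} \<and>
      (src e, g, m) \<notin> E \<and> (m, h, tgt e) \<notin> E \<and> (src e, g, m) \<noteq> (m, h, tgt e))"
proof -
  have fin: "finite E" using E by (auto simp: valid_def)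
  have inV: "src e \<in> V" "tgt e \<in> V" using edge_facts[OF E] e by auto
  show "valid E'"
    unfolding E'_def using E coh inV m by (intro valid_Un valid_Diff valid_piece) auto
  obtain q where q: "chain (src e) q m" "set q \<subseteq> piece (src e) g m \<union> loops" "word q = g"
    using piece_path[OF inV(1) m coh(1)] .
  obtain r where r: "chain m r (tgt e)" "set r \<subseteq> piece m h (tgt e) \<union> loops" "word r = h"
    using piece_path[OF m inV(2) coh(2)] .
  show "refines E E'"
    unfolding E'_def
    by (rule refines_replace[of _ "q @ r"]) (use q r e in \<open>auto simp: chain_append\<close>)
  define P Q where "P = piece (src e) g m" and "Q = piece m h (tgt e)"
  have PQ: "finite P" "finite Q" "card P \<le> 1" "card Q \<le> 1" "total_length P \<le> length g" "total_length Q \<le> length h"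
    unfolding P_def Q_def by (simp_all add: total_length_piece_le) (simp_all add: piece_def)
  have t: "total_length E = length g + length h + total_length (E - {e})"
    using total_length_remove[OF fin e(1)] e(2) by simp
  have c: "card (E - {e}) + 1 = card E" using e(1) fin by (metis Suc_eq_plus1 card_Suc_Diff1)
  have E': "E' = (E - {e}) \<union> (P \<union> Q)" by (simp add: E'_def P_def Q_def)
  have tU: "total_length (S \<union> R) \<le> total_length S + total_length R" if "finite S" "finite R" for S R :: "'a edge set"
    using that by (rule total_length_Un_le)
  have "total_length E' \<le> total_length (E - {e}) + (total_length P + total_length Q)"
    unfolding E' using tU[of "E - {e}" "P \<union> Q"] tU[of P Q] fin PQ(1,2) by simp
  then show "total_length E' \<le> total_length E" using PQ t by linarith
  have "card E' \<le> card (E - {e}) + (card P + card Q)"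
    unfolding E' using card_Un_le[of "E - {e}" "P \<union> Q"] card_Un_le[of P Q] by linarith
  then show "card E' \<le> Suc (card E)" using PQ c by linarith
  have red: "card E' \<le> card E \<and> total_length E' < total_length E"
    if R: "E' = (E - {e}) \<union> R" "R = P \<or> R = Q" for R
  proof -
    have "total_length E' \<le> total_length (E - {e}) + total_length R" "card E' \<le> card (E - {e}) + card R"
      unfolding R(1) using tU[of "E - {e}" R] card_Un_le[of "E - {e}" R] fin PQ R(2) by auto
    moreover have "0 < length g" "0 < length h" using e(3,4) by simp_all
    moreover have "total_length R \<le> length g \<or> total_length R \<le> length h" "card R \<le> 1"
      using R(2) PQ by auto
    ultimately show ?thesis using c t by linarith
  qed
  have ne: "(src e, g, m) \<noteq> e" "(m, h, tgt e) \<noteq> e" using e(2-4) by (auto simp: prod_eq_iff)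
  show "(card E' \<le> card E \<and> total_length E' < total_length E) \<or>
     (piece (src e) g m = {(src e, g, m)} \<and> piece m h (tgt e) = {(m, h, tgt e)} \<and>
      (src e, g, m) \<notin> E \<and> (m, h, tgt e) \<notin> E \<and> (src e, g, m) \<noteq> (m, h, tgt e))"
  proof (rule disjCI)
    assume "\<not> (piece (src e) g m = {(src e, g, m)} \<and> piece m h (tgt e) = {(m, h, tgt e)} \<and>
      (src e, g, m) \<notin> E \<and> (m, h, tgt e) \<notin> E \<and> (src e, g, m) \<noteq> (m, h, tgt e))"
    then consider "P \<subseteq> E - {e}" | "Q \<subseteq> E - {e}" | "P = Q"
      unfolding P_def Q_def piece_def using ne by (cases "length g < D"; cases "length h < D") auto
    then show "card E' \<le> card E \<and> total_length E' < total_length E"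
    proof cases
      case 1
      then show ?thesis using red[of Q] E' by blast
    next
      case 2
      then show ?thesis using red[of P] E' by blast
    next
      case 3
      then show ?thesis using red[of P] E' by blast
    qed
  qed
qed

definition irreducible :: "'a edge set \<Rightarrow> bool" where
  "irreducible E \<longleftrightarrow> valid E \<and>
     (\<forall>E'. valid E' \<longrightarrow> refines E E' \<longrightarrow> card E' \<le> card E \<longrightarrow> total_length E \<le> total_length E')"

lemma edge_at_position:
  assumes "c \<le> t" "t < c + int (length (word p))"
  obtains p1 e p2 where "p = p1 @ e # p2" "c + int (length (word p1)) \<le> t"
    "t < c + int (length (word p1)) + int (length (lab e))"
  using assms
proof (induction p arbitrary: c thesis)
  case (Cons e p)
  show ?case
  proof (cases "t < c + int (length (lab e))")
    case True
    then show ?thesis using Cons.prems(2) by (intro Cons.prems(1)[of "[]" e p]) auto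
  next
    case False
    obtain p1 f p2 where "p = p1 @ f # p2" "c + int (length (lab e)) + int (length (word p1)) \<le> t"
      "t < c + int (length (lab e)) + int (length (word p1)) + int (length (lab f))"
    proof (rule Cons.IH)
      show "c + int (length (lab e)) \<le> t" using False by simp
      show "t < c + int (length (lab e)) + int (length (word p))" using Cons.prems(3) by simp
    qed
    then show ?thesis by (intro Cons.prems(1)[of "e # p1" f p2]) auto
  qed
qed simp

lemma append_conv_longer:
  assumes "u @ v = u' @ v'" "length (word u) < length (word u')"
  obtains m where "u' = u @ m" "m \<noteq> []"
proof -
  from assms(1) consider m where "u = u' @ m" | m where "u' = u @ m"
    by (auto simp: append_eq_append_conv2)
  then show ?thesis
  proof cases
    case 1
    then show ?thesis using assms(2) by simp
  next
    case 2
    then show ?thesis using that assms(2) by (cases "m = []") auto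
  qed
qed

section \<open>Asymptotic pairs in an irreducible graph\<close>

lemma lab_length_le:
  assumes "valid E" "e \<in> E \<union> loops"
  shows "length (lab e) \<le> total_length E + D"
proof (cases "e \<in> E")
  case True
  then show ?thesis
    using assms(1) total_length_remove[of E e] by (simp add: valid_def)
next
  case False
  then show ?thesis using assms(2) loop_facts(5)[of e] by auto
qed

text \<open>A mark inside a loop would give a period of the vertex smaller than the least one.\<close>

lemma loop_not_cut:
  assumes "e \<in> loops" "m \<in> V" "coherent (src e, g, m)" "lab e = g @ h" "g \<noteq> []" "h \<noteq> []"
  shows False
proof -
  have "length g < D" using assms(4) loop_facts(5)[OF assms(1)] by simp
  obtain q where q: "chain (src e) q m" "set q \<subseteq> piece (src e) g m \<union> loops" "word q = g"
    using piece_path[OF loop_facts(1)[OF assms(1)] assms(2,3)] .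
  have "set q \<subseteq> loops" using q(2) \<open>length g < D\<close> by (simp add: piece_def)
  moreover obtain f r where f: "q = f # r" using q(3) assms(5) by (cases q) auto
  ultimately have "f \<in> loops" "src f = src e" using q(1) by auto
  then have "f = e" using assms(1) by (auto simp: loops_def loop_def)
  then have "length (lab e) \<le> length g" using q(3) f by auto
  then show False using assms(4,6) by simp
qed

text \<open>In an irreducible graph a foreign mark inside an edge always divides it into two long new
  edges, since otherwise cutting would reduce the graph.\<close>

lemma mark_inside_edge:
  assumes "irreducible E" "e \<in> E \<union> loops" "m \<in> V"
    and e: "mark x k (src e)" "spells x k (lab e)" "mark x (k + int (length (lab e))) (tgt e)"
    and m: "mark x (k + int d) m" "0 < d" "d < length (lab e)"
  shows "e \<in> E"
    "valid ((E - {e}) \<union> {(src e, take d (lab e), m), (m, drop d (lab e), tgt e)})"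
    "refines E ((E - {e}) \<union> {(src e, take d (lab e), m), (m, drop d (lab e), tgt e)})"
    "total_length ((E - {e}) \<union> {(src e, take d (lab e), m), (m, drop d (lab e), tgt e)})
       \<le> total_length E"
    "card ((E - {e}) \<union> {(src e, take d (lab e), m), (m, drop d (lab e), tgt e)}) \<le> Suc (card E)"
    "(m, drop d (lab e), tgt e) \<notin> E \<union> loops"
    "(src e, take d (lab e), m) \<noteq> (m, drop d (lab e), tgt e)"
proof -
  have E: "valid E" using assms(1) by (simp add: irreducible_def)
  define g h where "g = take d (lab e)" and "h = drop d (lab e)"
  have gh: "lab e = g @ h" "g \<noteq> []" "h \<noteq> []" "length g = d"
    using m by (auto simp: g_def h_def)
  have sp: "spells x k g" "spells x (k + int d) h"
    using e(2) gh(1,4) by (simp_all add: spells_append)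
  have coh: "coherent (src e, g, m)" "coherent (m, h, tgt e)"
  proof -
    show "coherent (src e, g, m)" using e(1) sp(1) m(1) gh(4) by (intro coherentI) auto
    have "int (length (lab e)) = int d + int (length h)" using gh by simp
    then show "coherent (m, h, tgt e)"
      using m(1) sp(2) e(3) by (intro coherentI[of x "k + int d"]) (auto simp: add.assoc)
  qed
  show eE: "e \<in> E"
    using loop_not_cut[OF _ assms(3) coh(1) gh(1-3)] assms(2) by blast
  note c = cut_edge[OF E eE gh(1-3) assms(3) coh]
  have "\<not> (card ((E - {e}) \<union> (piece (src e) g m \<union> piece m h (tgt e))) \<le> card E \<and>
      total_length ((E - {e}) \<union> (piece (src e) g m \<union> piece m h (tgt e))) < total_length E)"
    using assms(1) c(1,2) unfolding irreducible_def by (meson not_le)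
  then have fresh: "piece (src e) g m = {(src e, g, m)}" "piece m h (tgt e) = {(m, h, tgt e)}"
    "(m, h, tgt e) \<notin> E" "(src e, g, m) \<noteq> (m, h, tgt e)"
    using c(5) by blast+
  have un: "piece (src e) g m \<union> piece m h (tgt e) = {(src e, g, m), (m, h, tgt e)}"
    using fresh by auto
  have "(m, h, tgt e) \<notin> loops"
    using fresh(2) loop_facts(5)[of "(m, h, tgt e)"] by (auto simp: piece_def split: if_splits)
  with c(1-4)[unfolded un] fresh(3,4)
  show "valid ((E - {e}) \<union> {(src e, take d (lab e), m), (m, drop d (lab e), tgt e)})"
    "refines E ((E - {e}) \<union> {(src e, take d (lab e), m), (m, drop d (lab e), tgt e)})"
    "total_length ((E - {e}) \<union> {(src e, take d (lab e), m), (m, drop d (lab e), tgt e)})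
       \<le> total_length E"
    "card ((E - {e}) \<union> {(src e, take d (lab e), m), (m, drop d (lab e), tgt e)}) \<le> Suc (card E)"
    "(m, drop d (lab e), tgt e) \<notin> E \<union> loops"
    "(src e, take d (lab e), m) \<noteq> (m, drop d (lab e), tgt e)"
    by (simp_all add: g_def h_def)
qed

lemma parse_segment:
  assumes "valid E" "parse E x c (u @ q @ r) y z"
  obtains m n where "parse E x (c + int (length (word u))) q m n" "chain y u m"
    "chain y (u @ q) n"
proof -
  obtain m where m: "parse E x c u y m" "parse E x (c + int (length (word u))) (q @ r) m z"
    using parse_append[OF assms, of thesis] by blast
  obtain n where n: "parse E x (c + int (length (word u))) q m n"
    using parse_append[OF assms(1) m(2), of thesis] by blast
  show ?thesis
    by (rule that[OF n]) (use m n in \<open>auto simp: parse_def chain_append\<close>)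
qed

text \<open>Suppose that two marks of the second path lie at the same offset \<open>d\<close> inside two occurrences of the
  same edge \<open>e\<close> of the first. Cut \<open>e\<close> at \<open>d\<close> into \<open>a\<close> and \<open>b\<close>. Between the two marks the first path
  then starts with \<open>b\<close>, whereas the second starts with an old edge, with a loop, or with \<open>a\<close>; both read the same word
  from \<open>m\<close> to \<open>m\<close>. Removing this ambiguity compensates for the edge gained by the cut, and the total has
  become smaller.\<close>

lemma no_repeated_offset:
  assumes irr: "irreducible E"
    and P: "parse E x c p y z" "p = u1 @ e # v1" "p = u2 @ e # v2"
    and P': "parse E x' c' p' y' z'" "p' = u1' @ f1 # v1'" "p' = u2' @ f2 # v2'"
    and eq: "\<And>i. i < 0 \<Longrightarrow> x i = x' i"
    and src: "src f1 = src f2"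
    and k1: "c' + int (length (word u1')) = c + int (length (word u1)) + int d"
    and k2: "c' + int (length (word u2')) = c + int (length (word u2)) + int d"
    and d: "0 < d" "d < length (lab e)"
    and less: "c' + int (length (word u1')) < c' + int (length (word u2'))"
    and bound: "c' + int (length (word u2')) \<le> - int A"
  shows False
proof -
  have E: "valid E" using irr by (simp add: irreducible_def)
  let ?k1 = "c + int (length (word u1))"
  define m where "m = src f1"
  note e1 = parse_junction[OF E P(1)[unfolded P(2)]]
  note f1 = parse_junction[OF E P'(1)[unfolded P'(2)]]
  have m1: "mark x (?k1 + int d) m"
    unfolding m_def using f1(1) less bound
    by (intro mark_cong[of x' "?k1 + int d" "src f1" x]) (simp_all add: k1 eq)
  have mV: "m \<in> V" using f1(6) by (simp add: m_def)
  define a b where "a = (src e, take d (lab e), m)" and "b = (m, drop d (lab e), tgt e)"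
  define E' where "E' = (E - {e}) \<union> {a, b}"
  note I = mark_inside_edge[OF irr e1(4) mV e1(1-3) m1 d, folded a_def b_def, folded E'_def]
  define s where "s g = (if g = e then [a, b] else [g])" for g
  have s: "chain (src g) (s g) (tgt g) \<and> set (s g) \<subseteq> E' \<union> loops \<and> word (s g) = lab g"
    if "g \<in> E \<union> loops" for g
    using that by (cases "g = e") (auto simp: s_def a_def b_def E'_def)
  have "length (word u1) < length (word u2)" using less k1 k2 by simp
  then obtain t where t: "u2 = u1 @ t" "t \<noteq> []"
    using append_conv_longer[of u1 "e # v1" u2 "e # v2"] P(2,3) by metis
  obtain w where w: "u2 = u1 @ e # w"
  proof -
    have "t @ e # v2 = e # v1" using P(2,3) t by simp
    then show ?thesis using t that by (cases t) auto
  qed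
  have "length (word u1') < length (word u2')" using less by simp
  then obtain q where q: "u2' = u1' @ q" "q \<noteq> []"
    using append_conv_longer[of u1' "f1 # v1'" u2' "f2 # v2'"] P'(2,3) by metis
  obtain f r where fr: "q = f # r" using q(2) by (cases q) auto
  obtain w1 w2 where W: "parse E x ?k1 (e # w) w1 w2" "chain y (u1 @ e # w) w2"
  proof -
    have "parse E x c (u1 @ (e # w) @ (e # v2)) y z" using P(1,3) w by simp
    from parse_segment[OF E this] that show thesis by blast
  qed
  obtain q1 q2 where Q: "parse E x' (c' + int (length (word u1'))) q q1 q2" "chain y' u1' q1"
     "chain y' (u1' @ q) q2"
  proof -
    have "parse E x' c' (u1' @ q @ (f2 # v2')) y' z'" using P'(1,3) q(1) by simp
    from parse_segment[OF E this] that show thesis by blast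
  qed
  have q12: "q1 = m" "q2 = m"
  proof -
    show "q1 = m" using chain_unique[OF Q(2) f1(5)] by (simp add: m_def)
    have "chain y' u2' (src f2)"
      by (rule parse_junction(5)[OF E P'(1)[unfolded P'(3)]])
    then show "q2 = m" using chain_unique[OF Q(3)] q(1) src by (simp add: m_def)
  qed
  have w2: "w2 = src e"
    using chain_unique[OF W(2)] parse_junction(5)[OF E P(1)[unfolded P(3)]] w by simp
  have ewE: "set w \<subseteq> E \<union> loops" "chain (tgt e) w (src e)" "spells x ?k1 (lab e @ word w)"
    using W(1) w2 by (auto simp: parse_def)
  have qE: "set q \<subseteq> E \<union> loops" "chain m q m" "spells x' (?k1 + int d) (word q)"
    using Q(1) q12 k1 by (auto simp: parse_def)
  \<comment> \<open>the two paths from \<open>m\<close> to \<open>m\<close> between the marks\<close>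
  define p1 where "p1 = b # subst s w @ [a]"
  define p2 where "p2 = subst s q"
  note sw = subst_path[OF s ewE(1,2)] and sq = subst_path[OF s qE(1,2)]
  have len_q: "?k1 + int d + int (length (word q)) = c + int (length (word u2)) + int d"
    using k1 k2 q(1) by simp
  have len_w: "length (word q) = length (lab e) + length (word w)"
    using len_q w by simp
  have "word p1 = word p2"
  proof (rule spells_unique)
    have sp2: "spells x (?k1 + int (length (lab e) + length (word w))) (lab e)"
      using parse_junction(2)[OF E P(1)[unfolded P(3)]] w by (simp add: add.assoc)
    then have "spells x ?k1 ((lab e @ word w) @ lab e)"
      using ewE(3) by (simp add: spells_append add.assoc)
    moreover have "(lab e @ word w) @ lab e =
        take d (lab e) @ (drop d (lab e) @ word w @ take d (lab e)) @ drop d (lab e)"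
      by (metis append.assoc append_take_drop_id)
    moreover have "length (take d (lab e)) = d" using d by simp
    ultimately have "spells x (?k1 + int d) (drop d (lab e) @ word w @ take d (lab e))"
      by (simp only: spells_append)
    then show "spells x (?k1 + int d) (word p1)"
      using sw(3) by (simp add: p1_def a_def b_def)
    have "spells x (?k1 + int d) (word q) = spells x' (?k1 + int d) (word q)"
    proof (rule spells_cong)
      fix i assume "i < ?k1 + int d + int (length (word q))"
      then have "i < 0" using len_q k2 bound by simp
      then show "x i = x' i" by (rule eq)
    qed
    then show "spells x (?k1 + int d) (word p2)" using qE(3) sq(3) by (simp add: p2_def)
    show "length (word p1) = length (word p2)"
      using len_w d sw(3) sq(3) by (simp add: p1_def p2_def a_def b_def)
  qed
  moreover have "p1 \<noteq> p2"
  proof -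
    have "f \<in> E \<union> loops" using qE(1) fr by simp
    then have "hd p2 \<noteq> b" using I(6,7) fr by (auto simp: p2_def s_def)
    then show ?thesis by (auto simp: p1_def)
  qed
  moreover have "chain m p1 m" "chain m p2 m"
    using sw(1) sq(1) by (auto simp: p1_def p2_def a_def b_def chain_append)
  moreover have "set p1 \<subseteq> E' \<union> loops" "set p2 \<subseteq> E' \<union> loops"
    using sw(2) sq(2) by (auto simp: p1_def p2_def E'_def)
  ultimately obtain E'' where E'': "valid E''" "refines E' E''" "card E'' < card E'"
      "total_length E'' < total_length E'"
    using ambiguity_lowers_card[OF I(2), of p1 p2 m m] mV by blast
  have "refines E E''" using refines_trans[OF I(3) E''(2)] .
  then show False using irr E'' I(4,5) unfolding irreducible_def by fastforce
qed

text \<open>The state of a mark of the second path consists of the edge of the first path around it, the offset in this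
  edge, and the type of the mark. There are at most \<open>card E * (total_length E + D) * card V\<close> states
  if no mark is common to both paths, so the long stretch provided by \<open>N\<close> must show a
  state twice.\<close>

lemma common_mark:
  assumes irr: "irreducible E"
    and P: "parse E x c p y z" and P': "parse E x' c' p' y' z'"
    and eq: "\<And>i. i < 0 \<Longrightarrow> x i = x' i"
    and N: "N = A + (card E * (total_length E + D) * card V + 2) * (total_length E + D)"
    and c: "c \<le> - int N" "c' \<le> - int N"
      "0 \<le> c + int (length (word p))" "0 \<le> c' + int (length (word p'))"
  obtains p1 p2 q1 q2 where "p = p1 @ p2" "p' = q1 @ q2"
    "c + int (length (word p1)) = c' + int (length (word q1))"
    "c + int (length (word p1)) \<le> - int A"
proof (rule ccontr)
  assume no: "\<not> thesis"
  note found = that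
  have noshare: "c + int (length (word p1)) \<noteq> c' + int (length (word q1))"
    if pq: "p = p1 @ p2" "p' = q1 @ q2" "c + int (length (word p1)) \<le> - int A" for p1 p2 q1 q2
    using found[OF pq(1,2) _ pq(3)] no by blast
  have E: "valid E" using irr by (simp add: irreducible_def)
  define M where "M = total_length E + D"
  define B where "B = card E * M * card V"
  define S where "S = E \<times> {..<M} \<times> V"
  \<comment> \<open>no label is longer than \<open>M\<close>, so each interval of length \<open>M\<close> below \<open>T r\<close> contains
    a mark of the second path\<close>
  define T where "T r = - int A - int (r * M)" for r :: nat
  have "0 < M" using D_pos by (simp add: M_def)
  have A_pos: "0 < A" using D_pos D_le_A by simp
  define G where "G r t \<longleftrightarrow> (\<exists>u v u' f v'. p = u @ fst t # v \<and> p' = u' @ f # v' \<and>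
      src f = snd (snd t) \<and> c' + int (length (word u')) = c + int (length (word u)) + int (fst (snd t)) \<and>
      0 < fst (snd t) \<and> fst (snd t) < length (lab (fst t)) \<and>
      T r - int M < c' + int (length (word u')) \<and> c' + int (length (word u')) \<le> T r)"
    for r :: nat and t :: "'a edge \<times> nat \<times> (int \<Rightarrow> 'a)"
  have NB: "int N = int A + (int B + 2) * int M" by (simp add: N B_def M_def algebra_simps)
  have ex: "\<exists>t. t \<in> S \<and> G r t" if r: "r \<le> B" for r
  proof -
    have "r * M \<le> B * M" using r by simp
    then have T: "- int N + int M + int M \<le> T r" "T r \<le> - int A" "T r < 0"
      unfolding T_def NB using A_pos by (simp_all add: algebra_simps flip: of_nat_mult)
    have "c' \<le> T r" "T r < c' + int (length (word p'))" using T c by linarith+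
    then obtain u' f v' where f: "p' = u' @ f # v'" "c' + int (length (word u')) \<le> T r"
      "T r < c' + int (length (word u')) + int (length (lab f))"
      by (rule edge_at_position)
    note jf = parse_junction[OF E P'[unfolded f(1)]]
    define k where "k = c' + int (length (word u'))"
    have k: "T r - int M < k" "k \<le> T r"
      using f lab_length_le[OF E jf(4)] by (simp_all add: k_def M_def)
    have "c \<le> k" "k < c + int (length (word p))" using k T c \<open>0 < M\<close> by linarith+
    then obtain u e v where e: "p = u @ e # v" "c + int (length (word u)) \<le> k"
      "k < c + int (length (word u)) + int (length (lab e))"
      by (rule edge_at_position)
    note je = parse_junction[OF E P[unfolded e(1)]]
    have "c + int (length (word u)) \<noteq> k"
      unfolding k_def by (rule noshare[OF e(1) f(1)]) (use e(2) k(2) T(2) in simp)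
    define d where "d = nat (k - (c + int (length (word u))))"
    have d: "k = c + int (length (word u)) + int d" "0 < d" "d < length (lab e)"
      using e(2,3) \<open>c + int (length (word u)) \<noteq> k\<close> by (auto simp: d_def)
    have mk: "mark x (c + int (length (word u)) + int d) (src f)"
      using jf(1) k(2) T(2) unfolding k_def[symmetric] d(1)[symmetric]
      by (rule_tac mark_cong[of x' k "src f" x]) (auto simp: eq)
    have "e \<in> E"
      by (rule mark_inside_edge(1)[OF irr je(4) jf(6) je(1-3) mk d(2,3)])
    moreover have "d < M" using lab_length_le[OF E je(4)] d(3) by (simp add: M_def)
    ultimately have "(e, d, src f) \<in> S" using jf(6) by (simp add: S_def)
    moreover have "G r (e, d, src f)"
      unfolding G_def fst_conv snd_conv
      using e(1) f(1) d[unfolded k_def] k[unfolded k_def] by blast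
    ultimately show ?thesis by blast
  qed
  then obtain h where h: "\<And>r. r \<le> B \<Longrightarrow> h r \<in> S \<and> G r (h r)" by metis
  have contra: False if G: "G r t" "G s t" "r < s" for r s t
  proof -
    obtain e d m where t: "t = (e, d, m)" by (metis surj_pair)
    obtain u1 v1 u1' f1 v1' where 1: "p = u1 @ e # v1" "p' = u1' @ f1 # v1'" "src f1 = m"
      "c' + int (length (word u1')) = c + int (length (word u1)) + int d" "0 < d" "d < length (lab e)"
      "c' + int (length (word u1')) \<le> T s"
      using G(2) unfolding G_def t by auto
    obtain u2 v2 u2' f2 v2' where 2: "p = u2 @ e # v2" "p' = u2' @ f2 # v2'" "src f2 = m"
      "c' + int (length (word u2')) = c + int (length (word u2)) + int d"
      "T r - int M < c' + int (length (word u2'))" "c' + int (length (word u2')) \<le> T r"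
      using G(1) unfolding G_def t by auto
    have "(r + 1) * M \<le> s * M" using G(3) by (intro mult_right_mono) auto
    then have "T s \<le> T r - int M" unfolding T_def by (simp add: algebra_simps flip: of_nat_mult)
    then have less: "c' + int (length (word u1')) < c' + int (length (word u2'))"
      using 1(7) 2(5) by linarith
    have bound: "c' + int (length (word u2')) \<le> - int A"
      using 2(6) unfolding T_def by (smt (verit) of_nat_0_le_iff)
    show False
      using no_repeated_offset[OF irr P 1(1) 2(1) P' 1(2) 2(2) eq _ 1(4) 2(4) 1(5,6) less bound]
        1(3) 2(3) by simp
  qed
  have fE: "finite E" using E by (simp add: valid_def)
  have S: "finite S" "card S = B"
    using fE finite_V by (simp_all add: S_def B_def)
  have "card (h ` {..B}) \<le> card S" using h by (intro card_mono S) auto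
  then have "card (h ` {..B}) < card {..B}" using S by simp
  then have "\<not> inj_on h {..B}" by (rule pigeonhole)
  then obtain r s where rs: "r \<le> B" "s \<le> B" "r \<noteq> s" "h r = h s" by (auto simp: inj_on_def)
  then show False
    using contra[of r "h r" s] contra[of s "h r" r] h[of r] h[of s] by (metis linorder_neqE_nat)
qed

definition reads :: "'a edge set \<Rightarrow> (int \<Rightarrow> 'a) \<Rightarrow> bool" where
  "reads E x \<longleftrightarrow> (\<forall>N::nat. \<exists>c p y z. parse E x c p y z \<and> c \<le> - int N \<and>
     int N \<le> c + int (length (word p)))"

lemma reads_refines: "reads E x \<Longrightarrow> refines E E' \<Longrightarrow> reads E' x"
  unfolding reads_def by (metis parse_refines)

text \<open>Both points have a mark of the common start of \<open>a\<close> and \<open>b\<close> at \<open>k\<close>, then read \<open>a\<close> and \<open>b\<close>, respectively, and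
  the marks at the ends of these edges control the points beyond position \<open>0\<close>.\<close>

definition branching :: "'a edge set \<Rightarrow> 'a edge \<Rightarrow> 'a edge \<Rightarrow> int \<Rightarrow> (int \<Rightarrow> 'a) \<Rightarrow> (int \<Rightarrow> 'a) \<Rightarrow> bool" where
  "branching E a b k x x' \<longleftrightarrow> a \<in> E \<union> loops \<and> b \<in> E \<union> loops \<and> k \<le> 0 \<and>
     mark x k (src a) \<and> spells x k (lab a) \<and> mark x (k + int (length (lab a))) (tgt a) \<and>
     mark x' k (src b) \<and> spells x' k (lab b) \<and> mark x' (k + int (length (lab b))) (tgt b) \<and>
     - int A < k + int (length (lab a)) \<and> - int A < k + int (length (lab b))"

text \<open>An edge that ended earlier could be folded into the other one: the mark at its end lies
  entirely in the common past, so it is also a mark of the second point.\<close>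

lemma distinct_edges_end_late:
  assumes irr: "irreducible E" and ab: "a \<in> E \<union> loops" "b \<in> E \<union> loops" "a \<noteq> b" "src a = src b"
    and eq: "\<And>i. i < 0 \<Longrightarrow> x i = x' i"
    and a: "spells x k (lab a)" "mark x (k + int (length (lab a))) (tgt a)"
    and b: "spells x' k (lab b)" "mark x' (k + int (length (lab b))) (tgt b)"
    and le: "length (lab a) \<le> length (lab b)"
  shows "- int A < k + int (length (lab a))"
proof (rule ccontr)
  assume "\<not> - int A < k + int (length (lab a))"
  then have k: "k + int (length (lab a)) \<le> - int A" by simp
  have E: "valid E" using irr by (simp add: irreducible_def)
  have "spells x' k (lab a) = spells x k (lab a)" using k by (intro spells_cong) (auto simp: eq)
  then have a': "spells x' k (lab a)" using a(1) by simp
  have m: "mark x' (k + int (length (lab a))) (tgt a)"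
    by (rule mark_cong[OF a(2)]) (use k eq in auto)
  obtain g where g: "lab b = lab a @ g" "coherent (tgt a, g, tgt b)"
    using overlap_coherent[OF a' b(1) le m b(2)] .
  note f = fold_edge[OF E ab g]
  show False using irr f(2-5) unfolding irreducible_def by (meson not_le)
qed

lemma branching_exists:
  assumes irr: "irreducible E" and rd: "reads E x" "reads E x'"
    and eq: "\<And>i. i < 0 \<Longrightarrow> x i = x' i" and neq: "x 0 \<noteq> x' 0"
  obtains a b k where "branching E a b k x x'"
proof -
  have E: "valid E" using irr by (simp add: irreducible_def)
  define N where "N = A + (card E * (total_length E + D) * card V + 2) * (total_length E + D)"
  have N_pos: "0 < N" using D_pos D_le_A by (simp add: N_def)
  obtain c p y z where P: "parse E x c p y z" "c \<le> - int N" "int N \<le> c + int (length (word p))"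
    using rd(1) unfolding reads_def by blast
  obtain c' p' y' z' where P': "parse E x' c' p' y' z'" "c' \<le> - int N"
      "int N \<le> c' + int (length (word p'))"
    using rd(2) unfolding reads_def by blast
  have pos: "0 \<le> c + int (length (word p))" "0 \<le> c' + int (length (word p'))"
    using P(3) P'(3) by simp_all
  obtain p1 p2 q1 q2 where pq: "p = p1 @ p2" "p' = q1 @ q2"
    "c + int (length (word p1)) = c' + int (length (word q1))"
    "c + int (length (word p1)) \<le> - int A"
    using common_mark[OF irr P(1) P'(1) eq N_def P(2) P'(2) pos] .
  define l where "l = c + int (length (word p1))"
  obtain m where m: "m \<in> V" "mark x l m" "parse E x l p2 m z"
    using parse_append[OF E P(1)[unfolded pq(1)], of thesis] unfolding l_def by blast
  obtain m' where m': "m' \<in> V" "mark x' l m'" "parse E x' l q2 m' z'"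
    using parse_append[OF E P'(1)[unfolded pq(2)], of thesis] unfolding l_def pq(3) by blast
  have "m' i = m (i + int 0)" if "- int A \<le> i" "i < int A - int 0" for i
    using markD[OF m(2), of i] markD[OF m'(2), of i] that pq(4) eq[of "l + i"] by (simp add: l_def)
  then have mm: "m' = m" using rigid[OF m(1) m'(1) D_pos] by blast
  have len: "int N \<le> l + int (length (word p2))" "int N \<le> l + int (length (word q2))"
    using P(3) P'(3) pq(1-3) by (simp_all add: l_def)
  have no_ext: False if "p2 = u @ r" "q2 = u @ r'" "r = [] \<or> r' = []" for u r r'
  proof -
    have "int N \<le> l + int (length (word u))" using len that by auto
    moreover have "spells x l (word u)" "spells x' l (word u)"
      using m(3) m'(3) that by (auto simp: parse_def spells_append)
    moreover have "l \<le> 0" using pq(4) by (simp add: l_def)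
    ultimately have "x 0 = x' 0"
      using N_pos spells_at[of x l "word u" 0] spells_at[of x' l "word u" 0] by simp
    then show False using neq by simp
  qed
  obtain u a b p3 q3 where ab: "p2 = u @ a # p3" "q2 = u @ b # q3" "a \<noteq> b"
  proof (rule first_difference)
    show "p2 \<noteq> q2 @ r" for r using no_ext[of q2 r "[]"] by auto
    show "q2 \<noteq> p2 @ r" for r using no_ext[of p2 "[]" r] by auto
  qed
  define k where "k = l + int (length (word u))"
  note ja = parse_junction[OF E m(3)[unfolded ab(1)], folded k_def]
  note jb = parse_junction[OF E m'(3)[unfolded ab(2)], folded k_def]
  have s: "src a = src b" using chain_unique[OF ja(5)] jb(5) mm by blast
  have k0: "k \<le> 0"
  proof (rule ccontr)
    assume "\<not> k \<le> 0"
    have sp: "spells x l (word u)" "spells x' l (word u)"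
      using m(3) m'(3) ab by (auto simp: parse_def spells_append)
    have "l \<le> 0" using pq(4) by (simp add: l_def)
    then have "x 0 = x' 0"
      using \<open>\<not> k \<le> 0\<close> spells_at[OF sp(1), of 0] spells_at[OF sp(2), of 0] by (simp add: k_def)
    then show False using neq by simp
  qed
  have "- int A < k + int (length (lab a)) \<and> - int A < k + int (length (lab b))"
  proof (cases "length (lab a) \<le> length (lab b)")
    case True
    then show ?thesis
      using distinct_edges_end_late[OF irr ja(4) jb(4) ab(3) s eq ja(2,3) jb(2,3)] by simp
  next
    case False
    then show ?thesis
      using distinct_edges_end_late[OF irr jb(4) ja(4) ab(3)[symmetric] s[symmetric] eq[symmetric] jb(2,3) ja(2,3)]
      by simp
  qed
  then show ?thesis
    using that[of a b k] ja jb k0 by (simp add: branching_def)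
qed

definition extended :: "'a edge \<Rightarrow> int \<Rightarrow> 'a" where
  "extended a i = (if i < 0 then src a i else if i < int (length (lab a)) then lab a ! nat i
     else tgt a (i - int (length (lab a))))"

lemma extended_eq:
  assumes "mark x k (src a)" "spells x k (lab a)" "mark x (k + int (length (lab a))) (tgt a)"
    "- int A \<le> i" "i < int (length (lab a)) + int A"
  shows "x (k + i) = extended a i"
proof -
  consider "i < 0" | "0 \<le> i" "i < int (length (lab a))" | "int (length (lab a)) \<le> i" by linarith
  then show ?thesis
  proof cases
    case 1
    then show ?thesis using markD[OF assms(1,4)] by (simp add: extended_def)
  next
    case 2
    then show ?thesis using spells_at[OF assms(2), of "k + i"] by (simp add: extended_def)
  next
    case 3
    then show ?thesis using markD[OF assms(3), of "i - int (length (lab a))"] assms(5)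
      by (simp add: extended_def)
  qed
qed

text \<open>Along \<open>a\<close> and \<open>b\<close> the two points show the sequences \<open>extended a\<close> and \<open>extended b\<close>, at least up to
  position \<open>0\<close>. So \<open>- k\<close> is the first index at which these sequences differ, which depends only on \<open>a\<close>
  and \<open>b\<close>.\<close>

lemma branching_unique:
  assumes b1: "branching E a b k1 x1 x1'" "\<And>i. i < 0 \<Longrightarrow> x1 i = x1' i" "x1 0 \<noteq> x1' 0"
    and b2: "branching E a b k2 x2 x2'" "\<And>i. i < 0 \<Longrightarrow> x2 i = x2' i" "x2 0 \<noteq> x2' 0"
    and i: "- int A \<le> i" "i < 0"
  shows "x1 i = x2 i"
proof -
  have rd: "x (k + i) = extended a i" "x' (k + j) = extended b j"
    if "branching E a b k x x'" "- int A \<le> i" "i < int (length (lab a)) + int A"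
      "- int A \<le> j" "j < int (length (lab b)) + int A" for x x' k i j
    using that extended_eq by (auto simp: branching_def)
  have agree: "extended a i = extended b i"
    if "branching E a b k x x'" "\<forall>i<0. x i = x' i" "0 \<le> i" "i < - k" for x x' k i
    using rd[OF that(1), of i i] that by (simp add: branching_def)
  have differ: "extended a (- k) \<noteq> extended b (- k)"
    if "branching E a b k x x'" "x 0 \<noteq> x' 0" for x x' k
    using rd[OF that(1), of "- k" "- k"] that by (simp add: branching_def)
  have k0: "k1 \<le> 0" "k2 \<le> 0" using b1(1) b2(1) by (auto simp: branching_def)
  have "k1 = k2"
  proof (rule antisym)
    have "\<forall>i<0. x1 i = x1' i" "\<forall>i<0. x2 i = x2' i" using b1(2) b2(2) by blast+
    note ag = agree[OF b1(1) this(1), of "- k2"] agree[OF b2(1) this(2), of "- k1"]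
    show "k1 \<le> k2" using ag(2) differ[OF b1(1,3)] k0 by (cases "k1 \<le> k2") auto
    show "k2 \<le> k1" using ag(1) differ[OF b2(1,3)] k0 by (cases "k2 \<le> k1") auto
  qed
  then show ?thesis
    using rd(1)[OF b1(1), of "i - k1" "0"] rd(1)[OF b2(1), of "i - k1" 0] i k0 b1(1) D_pos D_le_A
    by (simp add: branching_def)
qed

lemma card_loops: "finite loops" "card loops \<le> card V"
proof -
  have "loops \<subseteq> loop ` V" by (auto simp: loops_def)
  then show "finite loops" "card loops \<le> card V"
    using finite_V by (auto intro: finite_subset card_image_le surj_card_le)
qed

lemma card_branching_le:
  assumes irr: "irreducible E"
    and f: "\<And>C. C \<in> F \<Longrightarrow> reads E (f C) \<and> reads E (f' C) \<and> (\<forall>i<0. f C i = f' C i) \<and> f C 0 \<noteq> f' C 0"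
    and sep: "\<And>C C'. C \<in> F \<Longrightarrow> C' \<in> F \<Longrightarrow> C \<noteq> C' \<Longrightarrow>
      \<exists>i. - int A \<le> i \<and> i < 0 \<and> f C i \<noteq> f C' i"
  shows "card F \<le> (card E + card V)\<^sup>2"
proof -
  have E: "valid E" using irr by (simp add: irreducible_def)
  then have fin: "finite (E \<union> loops)" using card_loops(1) by (simp add: valid_def)
  have "\<exists>ab. \<exists>k. branching E (fst ab) (snd ab) k (f C) (f' C)" if "C \<in> F" for C
  proof -
    obtain a b k where "branching E a b k (f C) (f' C)"
      by (rule branching_exists[OF irr, of "f C" "f' C"]) (use f[OF \<open>C \<in> F\<close>] in auto)
    then show ?thesis by (intro exI[of _ "(a, b)"] exI[of _ k]) simp
  qed
  then obtain h where h: "\<And>C. C \<in> F \<Longrightarrow> \<exists>k. branching E (fst (h C)) (snd (h C)) k (f C) (f' C)"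
    by metis
  have "inj_on h F"
  proof (rule inj_onI, rule ccontr)
    fix C C' assume C: "C \<in> F" "C' \<in> F" "h C = h C'" "C \<noteq> C'"
    obtain k k' where "branching E (fst (h C)) (snd (h C)) k (f C) (f' C)"
      "branching E (fst (h C)) (snd (h C)) k' (f C') (f' C')"
      using h[OF C(1)] h[OF C(2)] C(3) by auto
    then have "f C i = f C' i" if "- int A \<le> i" "i < 0" for i
      using branching_unique[of E _ _ k "f C" "f' C" k' "f C'" "f' C'" i] f[OF C(1)] f[OF C(2)] that
      by blast
    then show False using sep[OF C(1,2,4)] by blast
  qed
  moreover have "h ` F \<subseteq> (E \<union> loops) \<times> (E \<union> loops)"
  proof
    fix ab assume "ab \<in> h ` F"
    then obtain C where C: "C \<in> F" "ab = h C" by blast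
    then obtain k where "branching E (fst ab) (snd ab) k (f C) (f' C)" using h by blast
    then show "ab \<in> (E \<union> loops) \<times> (E \<union> loops)"
      unfolding branching_def mem_Times_iff by blast
  qed
  ultimately have "card F \<le> card ((E \<union> loops) \<times> (E \<union> loops))"
    using fin by (intro card_inj_on_le[of h]) auto
  also have "\<dots> = (card (E \<union> loops))\<^sup>2" by (simp add: card_cartesian_product power2_eq_square)
  also have "\<dots> \<le> (card E + card V)\<^sup>2"
    using card_Un_le[of E loops] card_loops(2) by (intro power_mono) auto
  finally show ?thesis .
qed

lemma irreducible_exists:
  assumes "valid E0" "\<And>x. x \<in> X \<Longrightarrow> reads E0 x"
  obtains E where "irreducible E" "card E \<le> card E0" "\<And>x. x \<in> X \<Longrightarrow> reads E x"
proof -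
  define Q where "Q E \<longleftrightarrow> valid E \<and> card E \<le> card E0 \<and> (\<forall>x\<in>X. reads E x)" for E
  have "Q E0" using assms by (simp add: Q_def)
  then obtain E where E: "Q E" "\<And>E'. Q E' \<Longrightarrow> total_length E \<le> total_length E'"
    using ex_has_least_nat[of Q E0 total_length] by blast
  have "irreducible E"
    unfolding irreducible_def
  proof (intro conjI allI impI)
    show "valid E" using E(1) by (simp add: Q_def)
    fix E' assume "valid E'" "refines E E'" "card E' \<le> card E"
    then have "Q E'" using E(1) reads_refines by (auto simp: Q_def)
    then show "total_length E \<le> total_length E'" by (rule E(2))
  qed
  then show ?thesis using that E(1) by (auto simp: Q_def)
qed

end

section \<open>The graph of the junctions of long words\<close>

text \<open>Compactness of a countable product of finite sets. The values of \<open>g\<close> are fixed one after the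
  other by the pigeonhole principle, keeping an infinite set of indices alive.\<close>

lemma pointwise_limit:
  fixes f :: "nat \<Rightarrow> nat \<Rightarrow> 'b"
  assumes "\<And>r. finite (range (\<lambda>j. f j r))"
  obtains g where "\<And>R. infinite {j. \<forall>r<R. f j r = g r}"
proof -
  define Q where "Q h R \<longleftrightarrow> infinite {j. \<forall>r<R. f j r = h r}" for h :: "nat \<Rightarrow> 'b" and R
  have step: "\<exists>v. Q (h(R := v)) (Suc R)" if h: "Q h R" for h R
  proof -
    let ?J = "{j. \<forall>r<R. f j r = h r}"
    have "finite ((\<lambda>j. f j R) ` ?J)" by (rule finite_subset[OF _ assms[of R]]) auto
    then obtain j0 where j0: "infinite {j \<in> ?J. f j R = f j0 R}"
      using pigeonhole_infinite[of ?J "\<lambda>j. f j R"] h unfolding Q_def by blast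
    have "{j \<in> ?J. f j R = f j0 R} \<subseteq> {j. \<forall>r<Suc R. f j r = (h(R := f j0 R)) r}"
      by (auto simp: less_Suc_eq)
    then have "Q (h(R := f j0 R)) (Suc R)" unfolding Q_def using j0 infinite_super by blast
    then show ?thesis by blast
  qed
  \<comment> \<open>\<open>H R\<close> carries the first \<open>R\<close> values of the limit\<close>
  define H where "H = rec_nat undefined (\<lambda>R h. h(R := SOME v. Q (h(R := v)) (Suc R)))"
  have H_Suc: "H (Suc R) = (H R)(R := SOME v. Q ((H R)(R := v)) (Suc R))" for R
    by (simp add: H_def)
  have QH: "Q (H R) R" for R
  proof (induction R)
    case (Suc R)
    show ?case unfolding H_Suc by (rule someI_ex) (rule step[OF Suc])
  qed (simp add: Q_def)
  have stable: "H (R + d) r = H R r" if "r < R" for R d r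
    using that by (induction d) (auto simp: H_Suc)
  have H_eq: "H (Suc r) r = H R r" if "r < R" for r R
    using stable[of r "Suc r" "R - Suc r"] that by simp
  have "infinite {j. \<forall>r<R. f j r = H (Suc r) r}" for R
    using QH[of R] H_eq[of _ R] by (simp add: Q_def cong: all_cong)
  then show ?thesis by (rule that)
qed

lemma word_limits:
  fixes w :: "nat \<Rightarrow> nat \<Rightarrow> 'a list"
  assumes S: "finite S" "\<And>j i. i < K \<Longrightarrow> set (w j i) \<subseteq> S"
    and grow: "\<And>R. \<exists>j0. \<forall>j\<ge>j0. \<forall>i<K. R \<le> length (w j i)"
  obtains pre suf :: "nat \<Rightarrow> nat \<Rightarrow> 'a" where
    "\<And>R. \<exists>j. \<forall>i<K. R \<le> length (w j i) \<and>
       (\<forall>r<R. w j i ! r = pre i r \<and> rev (w j i) ! r = suf i r)"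
proof -
  \<comment> \<open>\<open>None\<close> stands for the letters beyond the end of a word; it does not survive in the limit\<close>
  define nth' where "nth' l r = (if r < length l then Some (l ! r) else None)" for l :: "'a list" and r
  define f where "f j r = map (\<lambda>i. (nth' (w j i) r, nth' (rev (w j i)) r)) [0..<K]" for j r
  let ?S = "insert None (Some ` S)"
  have nth'_in: "nth' l r \<in> ?S" if "set l \<subseteq> S" for l r
    using that by (auto simp: nth'_def dest: nth_mem)
  have "finite (range (\<lambda>j. f j r))" for r
  proof (rule finite_subset)
    show "range (\<lambda>j. f j r) \<subseteq> {l. set l \<subseteq> ?S \<times> ?S \<and> length l = K}"
    proof
      fix l assume "l \<in> range (\<lambda>j. f j r)"
      then obtain j where l: "l = f j r" by blast
      have mem: "(nth' (w j i) r, nth' (rev (w j i)) r) \<in> ?S \<times> ?S" if "i < K" for i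
        using nth'_in[of "w j i" r] nth'_in[of "rev (w j i)" r] S(2)[OF that, of j]
        unfolding set_rev by blast
      have "set (f j r) \<subseteq> ?S \<times> ?S"
        unfolding f_def set_map set_upt by (rule image_subsetI, rule mem) simp
      then show "l \<in> {l. set l \<subseteq> ?S \<times> ?S \<and> length l = K}" unfolding l by (simp add: f_def)
    qed
    show "finite {l. set l \<subseteq> ?S \<times> ?S \<and> length l = K}"
      using S(1) by (intro finite_lists_length_eq) auto
  qed
  then obtain g where g: "\<And>R. infinite {j. \<forall>r<R. f j r = g r}" using pointwise_limit[of f] by blast
  have "\<exists>j. \<forall>i<K. R \<le> length (w j i) \<and>
       (\<forall>r<R. w j i ! r = the (fst (g r ! i)) \<and> rev (w j i) ! r = the (snd (g r ! i)))" for R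
  proof -
    obtain j0 where j0: "\<And>j i. j0 \<le> j \<Longrightarrow> i < K \<Longrightarrow> R \<le> length (w j i)" using grow by blast
    obtain j where j: "j0 \<le> j" "\<forall>r<R. f j r = g r"
      using g[of R] unfolding infinite_nat_iff_unbounded_le by blast
    have "w j i ! r = the (fst (g r ! i)) \<and> rev (w j i) ! r = the (snd (g r ! i))"
      if "i < K" "r < R" for i r
    proof -
      have "g r ! i = (nth' (w j i) r, nth' (rev (w j i)) r)"
        using j(2)[rule_format, OF that(2), symmetric] that(1) by (simp add: f_def)
      then show ?thesis using j0[OF j(1) that(1)] that(2) by (simp add: nth'_def)
    qed
    then show ?thesis using j0[OF j(1)] by blast
  qed
  then show ?thesis by (rule that)
qed

lemma orbit_iff: "z \<in> orbit y \<longleftrightarrow> (\<exists>t. \<forall>k. z k = y (k + t))"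
  by (auto simp: orbit_def shift_pow_def fun_eq_iff)

lemma orbit_eq:
  assumes "z \<in> orbit y"
  shows "orbit z = orbit y"
proof -
  obtain t where t: "\<And>k. z k = y (k + t)" using assms by (auto simp: orbit_iff)
  have "u \<in> orbit y" if u: "u \<in> orbit z" for u
  proof -
    obtain s where "\<And>k. u k = z (k + s)" using u unfolding orbit_iff by blast
    then have "u k = y (k + (s + t))" for k by (simp add: t add.assoc)
    then show ?thesis unfolding orbit_iff by blast
  qed
  moreover have "u \<in> orbit z" if u: "u \<in> orbit y" for u
  proof -
    obtain s where "\<And>k. u k = y (k + s)" using u unfolding orbit_iff by blast
    then have "u k = z (k + (s - t))" for k by (simp add: t)
    then show ?thesis unfolding orbit_iff by blast
  qed
  ultimately show ?thesis by blast
qed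

lemma orbit_refl: "y \<in> orbit y"
  unfolding orbit_iff by (intro exI[of _ 0]) simp

text \<open>Choosing a representative of each orbit makes the vertices pairwise inequivalent under the
  shift, so that nearby marks have the same type.\<close>

definition representative :: "(int \<Rightarrow> 'a) \<Rightarrow> (int \<Rightarrow> 'a)" where
  "representative y = (SOME z. z \<in> orbit y)"

lemma representative_in_orbit: "representative y \<in> orbit y"
  unfolding representative_def by (rule someI[of _ y]) (rule orbit_refl)

lemma representative_unique:
  assumes "representative z \<in> orbit (representative y)"
  shows "representative z = representative y"
proof -
  have "orbit z = orbit y"
    using orbit_eq[OF assms] orbit_eq[OF representative_in_orbit[of z]]
      orbit_eq[OF representative_in_orbit[of y]] by simp
  then show ?thesis by (simp add: representative_def)
qed

text \<open>For each of the finitely many triples \<open>(y, z, d)\<close> with \<open>z\<close> different from \<open>y\<close> shifted by \<open>d\<close>,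
  a large enough window shows a difference.\<close>

lemma rigid_types_exist:
  fixes V :: "(int \<Rightarrow> 'a) set"
  assumes fin: "finite V" and trans: "\<And>y z. y \<in> V \<Longrightarrow> z \<in> V \<Longrightarrow> z \<in> orbit y \<Longrightarrow> z = y"
  obtains D A where "rigid_types V D A" "L \<le> A"
proof -
  define D where "D = Suc (\<Sum>y\<in>V. min_period y)"
  have D: "min_period y < D" if "y \<in> V" for y
    using member_le_sum[of y V min_period] that fin by (simp add: D_def)
  define ok where "ok t A \<longleftrightarrow> (case t of (y, z, d) \<Rightarrow>
      (\<forall>i. - int A \<le> i \<longrightarrow> i < int A - int d \<longrightarrow> z i = y (i + int d)) \<longrightarrow>
      (\<forall>i. z i = y (i + int d)))" for t :: "(int \<Rightarrow> 'a) \<times> (int \<Rightarrow> 'a) \<times> nat" and A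
  have "eventually (ok t) sequentially" for t
  proof -
    obtain y z d where t: "t = (y, z, d)" by (cases t) auto
    show ?thesis
    proof (cases "\<forall>i. z i = y (i + int d)")
      case True
      then have "ok t = (\<lambda>_. True)" by (simp add: t ok_def fun_eq_iff)
      then show ?thesis by simp
    next
      case False
      then obtain i where i: "z i \<noteq> y (i + int d)" by blast
      have "ok t A" if "nat \<bar>i\<bar> + d + 1 \<le> A" for A
        using i that unfolding t ok_def by (auto dest!: spec[of _ i])
      then show ?thesis unfolding eventually_sequentially by blast
    qed
  qed
  moreover have "finite (V \<times> V \<times> {..<D})" using fin by simp
  ultimately have "eventually (\<lambda>A. \<forall>t\<in>V \<times> V \<times> {..<D}. ok t A) sequentially"
    by (intro eventually_ball_finite) blast+
  then have "eventually (\<lambda>A. (\<forall>t\<in>V \<times> V \<times> {..<D}. ok t A) \<and> max L D \<le> A) sequentially"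
    using eventually_ge_at_top by (rule eventually_conj)
  then obtain A where A: "\<And>t. t \<in> V \<times> V \<times> {..<D} \<Longrightarrow> ok t A" "L \<le> A" "D \<le> A"
    unfolding eventually_sequentially by force
  have "rigid_types V D A"
  proof
    fix y z d assume *: "y \<in> V" "z \<in> V" "d < D"
      "\<And>i. - int A \<le> i \<Longrightarrow> i < int A - int d \<Longrightarrow> z i = y (i + int d)"
    then have eq: "\<forall>i. z i = y (i + int d)" using A(1)[of "(y, z, d)"] by (auto simp: ok_def)
    then have "z \<in> orbit y" unfolding orbit_iff by blast
    then have "z = y" using trans * by blast
    then show "z = y \<and> (d = 0 \<or> periodic y d)" using eq by (auto simp: periodic_def)
  qed (use fin A D in \<open>auto simp: D_def\<close>)
  then show ?thesis using that A by blast
qed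

text \<open>The limit picture at a place where the word \<open>i\<close> is followed by the word \<open>i'\<close>: \<open>suf i r\<close> is the \<open>r\<close>-th
  letter from the end of the left word, so coordinate \<open>-1\<close> corresponds to \<open>r = 0\<close>.\<close>

definition junction :: "(nat \<Rightarrow> nat \<Rightarrow> 'a) \<Rightarrow> (nat \<Rightarrow> nat \<Rightarrow> 'a) \<Rightarrow> nat \<Rightarrow> nat \<Rightarrow> int \<Rightarrow> 'a" where
  "junction pre suf i i' k = (if 0 \<le> k then pre i' (nat k) else suf i (nat (- 1 - k)))"

lemma junction_in_word:
  assumes "spells x c (w @ w')" "R \<le> length w" "R \<le> length w'"
    and "\<And>r. r < R \<Longrightarrow> rev w ! r = suf i r" "\<And>r. r < R \<Longrightarrow> w' ! r = pre i' r"
    and "- int R \<le> k" "k < int R"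
  shows "x (c + int (length w) + k) = junction pre suf i i' k"
proof (cases "0 \<le> k")
  case True
  have "spells x (c + int (length w)) w'" using assms(1) by (simp add: spells_append)
  then have "x (c + int (length w) + k) = w' ! nat k"
    using spells_at[of x "c + int (length w)" w' "c + int (length w) + k"] True assms(3,7) by simp
  then show ?thesis using assms(5)[of "nat k"] True assms(7) by (simp add: junction_def)
next
  case False
  define r where "r = nat (- 1 - k)"
  have r: "r < R" "r < length w" using False assms(2,6) by (auto simp: r_def)
  have "spells x c w" using assms(1) by (simp add: spells_append)
  then have "x (c + int (length w - Suc r)) = w ! (length w - Suc r)"
    unfolding spells_def using r by (metis diff_less zero_less_Suc less_nat_zero_code neq0_conv)
  moreover have "c + int (length w) + k = c + int (length w - Suc r)"
    using False r by (simp add: r_def of_nat_diff)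
  ultimately have "x (c + int (length w) + k) = w ! (length w - Suc r)" by (simp only:)
  also have "\<dots> = rev w ! r" using r by (simp add: rev_nth)
  finally show ?thesis using assms(4)[OF r(1)] False by (simp add: junction_def r_def)
qed

lemma length_infix: "b \<le> length u \<Longrightarrow> length (take (b - a) (drop a u)) = b - a"
  by simp

lemma spells_infix:
  assumes "spells x c u" "a \<le> b" "b \<le> length u"
  shows "spells x (c + int a) (take (b - a) (drop a u))"
  using assms by (auto simp: spells_def add.assoc simp flip: of_nat_add)

text \<open>A finitary way of saying that \<open>x\<close> is a two-sided concatenation of the words \<open>w i\<close>: arbitrarily long
  central pieces are finite concatenations.\<close>

definition tiled :: "nat \<Rightarrow> (nat \<Rightarrow> 'a list) \<Rightarrow> (int \<Rightarrow> 'a) \<Rightarrow> bool" where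
  "tiled K w x \<longleftrightarrow> (\<forall>N. \<exists>c us. set us \<subseteq> {..<K} \<and> c \<le> - int N \<and>
     int N \<le> c + int (length (concat (map w us))) \<and> spells x c (concat (map w us)))"

context rigid_types begin

lemma mark_iff: "mark x k y \<longleftrightarrow> (\<forall>i. - int A \<le> i \<longrightarrow> i < int A \<longrightarrow> x (k + i) = y i)"
proof
  assume "mark x k y"
  then show "\<forall>i. - int A \<le> i \<longrightarrow> i < int A \<longrightarrow> x (k + i) = y i" using markD by blast
next
  assume "\<forall>i. - int A \<le> i \<longrightarrow> i < int A \<longrightarrow> x (k + i) = y i"
  then show "mark x k y" unfolding mark_def lmark_def rmark_def by simp
qed

fun triple_path :: "(nat \<Rightarrow> nat \<Rightarrow> nat \<Rightarrow> 'a edge) \<Rightarrow> nat list \<Rightarrow> 'a edge list" where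
  "triple_path e (i # i' # i'' # us) = e i i' i'' # triple_path e (i' # i'' # us)"
| "triple_path e us = []"

text \<open>Marks are placed not at the junctions of words but at distance \<open>off\<close> from them, where the chosen
  representative of the limit picture has its origin. The edge between two consecutive marks depends on three
  consecutive words: the middle one, and its neighbours because the offsets depend on them.\<close>

lemma junction_graph:
  fixes w :: "nat \<Rightarrow> 'a list" and off :: "nat \<Rightarrow> nat \<Rightarrow> int" and y :: "nat \<Rightarrow> nat \<Rightarrow> int \<Rightarrow> 'a"
  assumes y: "\<And>i i'. i < K \<Longrightarrow> i' < K \<Longrightarrow> y i i' \<in> V"
    and off: "\<And>i i'. i < K \<Longrightarrow> i' < K \<Longrightarrow> \<bar>off i i'\<bar> \<le> int S"
    and long: "\<And>i. i < K \<Longrightarrow> 2 * S + A \<le> length (w i)"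
    and marked: "\<And>i i' x c. i < K \<Longrightarrow> i' < K \<Longrightarrow> spells x c (w i @ w i') \<Longrightarrow>
      mark x (c + int (length (w i)) + off i i') (y i i')"
  obtains E where "valid E" "card E \<le> K ^ 3"
    "\<forall>x. tiled K w x \<longrightarrow> reads E x"
proof -
  define s t where "s i i' = nat (int (length (w i)) + off i i')"
    and "t i i' i'' = nat (int (length (w i) + length (w i')) + off i' i'')" for i i' i''
  define e where "e i i' i'' =
    (y i i', take (t i i' i'' - s i i') (drop (s i i') (w i @ w i' @ w i'')), y i' i'')" for i i' i''
  define E where "E = (\<lambda>(i, i', i''). e i i' i'') ` ({..<K} \<times> {..<K} \<times> {..<K})"
  have A: "0 < A" using D_pos D_le_A by simp
  have ends: "src (e i i' i'') = y i i'" "tgt (e i i' i'') = y i' i''" for i i' i''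
    by (simp_all add: e_def)
  have st: "int (s i i') = int (length (w i)) + off i i'"
    "int (t i i' i'') = int (length (w i) + length (w i')) + off i' i''"
    "s i i' \<le> t i i' i''" "t i i' i'' \<le> length (w i @ w i' @ w i'')" "A \<le> t i i' i'' - s i i'"
    if "i < K" "i' < K" "i'' < K" for i i' i''
    using off[OF that(1,2)] off[OF that(2,3)] long[OF that(1)] long[OF that(2)] long[OF that(3)]
    by (simp_all add: s_def t_def)
  have len: "int (length (lab (e i i' i''))) = int (length (w i')) + off i' i'' - off i i'"
    "A \<le> length (lab (e i i' i''))" if "i < K" "i' < K" "i'' < K" for i i' i''
  proof -
    have "length (lab (e i i' i'')) = t i i' i'' - s i i'"
      unfolding e_def fst_conv snd_conv by (rule length_infix[OF st(4)[OF that]])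
    then show "int (length (lab (e i i' i''))) = int (length (w i')) + off i' i'' - off i i'"
      "A \<le> length (lab (e i i' i''))"
      using st[OF that] by simp_all
  qed
  have sp: "spells x (c + int (length (w i)) + off i i') (lab (e i i' i''))"
    if "i < K" "i' < K" "i'' < K" "spells x c (w i @ w i' @ w i'')" for i i' i'' x c
    using spells_infix[OF that(4) st(3,4)[OF that(1-3)]] st(1)[OF that(1-3)]
    by (simp add: e_def add.assoc)
  have coh: "coherent (e i i' i'')" if "i < K" "i' < K" "i'' < K" for i i' i''
  proof -
    define u where "u = w i @ w i' @ w i''"
    define x where "x k = u ! nat k" for k :: int
    have x: "spells x 0 u" by (simp add: spells_def x_def)
    have "mark x (0 + int (length (w i)) + off i i') (y i i')"
      using x by (intro marked that) (simp add: u_def spells_append)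
    moreover have "mark x (int (length (w i)) + int (length (w i')) + off i' i'') (y i' i'')"
      using x by (intro marked that) (simp add: u_def spells_append)
    moreover have "spells x (0 + int (length (w i)) + off i i') (lab (e i i' i''))"
      using x by (intro sp that) (simp add: u_def)
    moreover have pos: "int (length (w i)) + off i i' + int (length (lab (e i i' i''))) =
        int (length (w i)) + int (length (w i')) + off i' i''"
      using len(1)[OF that] by simp
    ultimately show ?thesis
      unfolding coherent_def ends using pos
      by (intro exI[of _ x] exI[of _ "int (length (w i)) + off i i'"]) (simp only: pos add_0)
  qed
  have "valid E"
    unfolding valid_def
  proof (intro conjI ballI)
    show "finite E" by (simp add: E_def)
    fix a assume "a \<in> E"
    then obtain i i' i'' where i: "i < K" "i' < K" "i'' < K" "a = e i i' i''" by (auto simp: E_def)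
    show "coherent a" unfolding i(4) by (rule coh[OF i(1-3)])
    show "D \<le> length (lab a)" unfolding i(4) using len(2)[OF i(1-3)] D_le_A by simp
    show "src a \<in> V" "tgt a \<in> V" using i y by (simp_all add: e_def)
  qed
  moreover have "card E \<le> K ^ 3"
    unfolding E_def
    by (rule order_trans[OF card_image_le]) (simp_all add: power3_eq_cube)
  moreover have "reads E x" if x: "tiled K w x" for x
    unfolding reads_def
  proof
    fix N
    define M where "M = (\<Sum>i<K. length (w i)) + S"
    have M: "length (w i) + S \<le> M" if "i < K" for i
      using member_le_sum[of i "{..<K}" "\<lambda>i. length (w i)"] that by (simp add: M_def)
    have path: "\<exists>z. set (triple_path e (i # i' # us)) \<subseteq> E \<and> chain (y i i') (triple_path e (i # i' # us)) z \<and>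
        spells x (c + int (length (w i)) + off i i') (word (triple_path e (i # i' # us))) \<and>
        mark x (c + int (length (w i)) + off i i' + int (length (word (triple_path e (i # i' # us))))) z \<and>
        c + int (length (concat (map w (i # i' # us)))) - int M \<le>
          c + int (length (w i)) + off i i' + int (length (word (triple_path e (i # i' # us))))"
      if "set (i # i' # us) \<subseteq> {..<K}" "spells x c (concat (map w (i # i' # us)))" for i i' us c
      using that
    proof (induction us arbitrary: i i' c)
      case Nil
      then have i: "i < K" "i' < K" by auto
      have "mark x (c + int (length (w i)) + off i i') (y i i')"
        by (rule marked[OF i]) (use Nil in simp)
      then show ?case using M[OF i(2)] off[OF i] by simp
    next
      case (Cons i'' us)
      then have i: "i < K" "i' < K" "i'' < K" by auto
      let ?l = "length (lab (e i i' i''))"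
      have pos: "c + int (length (w i)) + off i i' + int ?l =
          c + int (length (w i)) + int (length (w i')) + off i' i''"
        using len(1)[OF i] by simp
      have u: "spells x c (w i @ w i' @ w i'')"
        using Cons.prems(2) by (simp add: spells_append)
      obtain z where z: "set (triple_path e (i' # i'' # us)) \<subseteq> E" "chain (y i' i'') (triple_path e (i' # i'' # us)) z"
        "spells x (c + int (length (w i)) + int (length (w i')) + off i' i'') (word (triple_path e (i' # i'' # us)))"
        "mark x (c + int (length (w i)) + int (length (w i')) + off i' i'' +
            int (length (word (triple_path e (i' # i'' # us))))) z"
        "c + int (length (w i)) + int (length (concat (map w (i' # i'' # us)))) - int M \<le>
          c + int (length (w i)) + int (length (w i')) + off i' i'' +
            int (length (word (triple_path e (i' # i'' # us))))"
        using Cons.IH[of i' i'' "c + int (length (w i))"] Cons.prems by (auto simp: spells_append)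
      have "e i i' i'' \<in> E" unfolding E_def using i by force
      then show ?case
        using z(1,2) z(3-5)[folded pos] sp[OF i u]
        by (intro exI[of _ z]) (simp add: ends spells_append add.assoc[symmetric])
    qed
    obtain c us where us: "set us \<subseteq> {..<K}" "c \<le> - int (N + M)"
        "int (N + M) \<le> c + int (length (concat (map w us)))" "spells x c (concat (map w us))"
      using x unfolding tiled_def by blast
    have "\<exists>i i' vs. us = i # i' # vs"
    proof (rule ccontr)
      assume "\<nexists>i i' vs. us = i # i' # vs"
      then consider "us = []" | i where "us = [i]" by (metis list.exhaust)
      then have "length (concat (map w us)) + S \<le> M"
        using us(1) M by cases (auto simp: M_def)
      moreover have "0 < length (concat (map w us))"
      proof (rule ccontr)
        assume "\<not> 0 < length (concat (map w us))"
        then have "length (concat (map w us)) = 0" by blast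
        then have "M = 0" using us(2,3) by linarith
        moreover have "0 < K" using x[unfolded tiled_def, rule_format, of 1] by (cases K) auto
        ultimately show False using M[of 0] long[of 0] A by simp
      qed
      ultimately show False using us(2,3) by simp
    qed
    then obtain i i' vs where vs: "us = i # i' # vs" by blast
    then have i: "i < K" "i' < K" using us(1) by auto
    let ?p = "triple_path e us" and ?k = "c + int (length (w i)) + off i i'"
    obtain z where z: "set ?p \<subseteq> E" "chain (y i i') ?p z" "spells x ?k (word ?p)"
      "mark x (?k + int (length (word ?p))) z"
      "c + int (length (concat (map w us))) - int M \<le> ?k + int (length (word ?p))"
      using path[of i i' vs c] us vs by blast
    have "mark x ?k (y i i')" by (rule marked[OF i]) (use us(4) vs in \<open>simp add: spells_append\<close>)
    then have "parse E x ?k ?p (y i i') z"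
      unfolding parse_def using z y[OF i] by (auto simp: mark_def)
    moreover have "?k \<le> - int N" using us(2) M[OF i(1)] off[OF i] by simp
    moreover have "int N \<le> ?k + int (length (word ?p))" using z(5) us(3) by simp
    ultimately show "\<exists>c p y z. parse E x c p y z \<and> c \<le> - int N \<and> int N \<le> c + int (length (word p))"
      by blast
  qed
  ultimately show ?thesis using that by blast
qed

end

text \<open>The combinatorial core, for points that are tiled by \<open>K\<close> words of arbitrarily large lengths. The radius
  \<open>A\<close> must exceed the length \<open>L\<close> of a window that already separates the pasts of the
  members of \<open>F\<close>; the level \<open>j\<close> of the tiling words is chosen last.\<close>

theorem card_asymptotic_pairs_of_tiled_points_le:
  fixes w :: "nat \<Rightarrow> nat \<Rightarrow> 'a list" and X :: "(int \<Rightarrow> 'a) set"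
  assumes S: "finite S" "\<And>j i. i < K \<Longrightarrow> set (w j i) \<subseteq> S"
    and grow: "\<And>R. \<exists>j0. \<forall>j\<ge>j0. \<forall>i<K. R \<le> length (w j i)"
    and tiled: "\<And>x j. x \<in> X \<Longrightarrow> tiled K (w j) x"
    and F: "finite F"
    and f: "\<And>C. C \<in> F \<Longrightarrow> f C \<in> X \<and> f' C \<in> X \<and> (\<forall>i<0. f C i = f' C i) \<and> f C 0 \<noteq> f' C 0"
    and sep: "\<And>C C'. C \<in> F \<Longrightarrow> C' \<in> F \<Longrightarrow> C \<noteq> C' \<Longrightarrow> \<exists>i<0. f C i \<noteq> f C' i"
  shows "card F \<le> (K ^ 3 + K\<^sup>2)\<^sup>2"
proof -
  obtain pre suf where lim: "\<And>R. \<exists>j. \<forall>i<K. R \<le> length (w j i) \<and>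
       (\<forall>r<R. w j i ! r = pre i r \<and> rev (w j i) ! r = suf i r)"
    using word_limits[OF S grow] by blast
  define y where "y i i' = representative (junction pre suf i i')" for i i'
  define V where "V = (\<lambda>(i, i'). y i i') ` ({..<K} \<times> {..<K})"
  have V: "finite V" "card V \<le> K\<^sup>2"
    unfolding V_def by simp (rule order_trans[OF card_image_le], simp_all add: power2_eq_square)
  have yV: "y i i' \<in> V" if "i < K" "i' < K" for i i' using that by (force simp: V_def)
  have trans: "z = u" if "u \<in> V" "z \<in> V" "z \<in> orbit u" for u z
    using that representative_unique unfolding V_def y_def by fastforce
  define off where "off i i' = (SOME s. \<forall>k. y i i' k = junction pre suf i i' (k + s))" for i i'
  have off: "y i i' k = junction pre suf i i' (k + off i i')" for i i' k
  proof -
    have "\<exists>s. \<forall>k. y i i' k = junction pre suf i i' (k + s)"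
      using representative_in_orbit unfolding y_def orbit_iff by blast
    then show ?thesis unfolding off_def by (rule someI_ex[THEN spec])
  qed
  define m where "m = (\<Sum>(i, i')\<in>{..<K} \<times> {..<K}. nat \<bar>off i i'\<bar>)"
  have m: "\<bar>off i i'\<bar> \<le> int m" if "i < K" "i' < K" for i i'
  proof -
    have "nat \<bar>off i i'\<bar> \<le> m"
      using member_le_sum[of "(i, i')" "{..<K} \<times> {..<K}" "\<lambda>(i, i'). nat \<bar>off i i'\<bar>"] that
      unfolding m_def by simp
    then show ?thesis by simp
  qed
  have "\<exists>L. \<forall>t\<in>F \<times> F. fst t \<noteq> snd t \<longrightarrow> (\<exists>i<0. - int L \<le> i \<and> f (fst t) i \<noteq> f (snd t) i)"
  proof -
    have "eventually (\<lambda>L. fst t \<noteq> snd t \<longrightarrow> (\<exists>i<0. - int L \<le> i \<and> f (fst t) i \<noteq> f (snd t) i)) sequentially"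
      if t: "t \<in> F \<times> F" for t
    proof (cases "fst t = snd t")
      case False
      then obtain i where i: "i < 0" "f (fst t) i \<noteq> f (snd t) i"
        using sep[of "fst t" "snd t"] t by auto
      have "\<exists>i<0. - int L \<le> i \<and> f (fst t) i \<noteq> f (snd t) i" if "nat (- i) \<le> L" for L
        using i that by (intro exI[of _ i]) auto
      then show ?thesis unfolding eventually_sequentially by blast
    qed simp
    then have "eventually (\<lambda>L. \<forall>t\<in>F \<times> F. fst t \<noteq> snd t \<longrightarrow>
        (\<exists>i<0. - int L \<le> i \<and> f (fst t) i \<noteq> f (snd t) i)) sequentially"
      using F by (intro eventually_ball_finite) auto
    then show ?thesis unfolding eventually_sequentially by blast
  qed
  then obtain L where L: "\<forall>t\<in>F \<times> F. fst t \<noteq> snd t \<longrightarrow>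
      (\<exists>i<0. - int L \<le> i \<and> f (fst t) i \<noteq> f (snd t) i)" by blast
  have L: "\<exists>i<0. - int L \<le> i \<and> f C i \<noteq> f C' i" if "C \<in> F" "C' \<in> F" "C \<noteq> C'" for C C'
    using L[rule_format, of "(C, C')"] that by simp
  obtain D A where DA: "rigid_types V D A" "L \<le> A"
    using rigid_types_exist[OF V(1) trans] by blast
  interpret rigid_types V D A by (rule DA(1))
  \<comment> \<open>a window of radius \<open>A\<close> around a mark stays within \<open>m + A\<close> of the junction, and an edge is shorter than
    its middle word by at most \<open>2 * m\<close>\<close>
  define R where "R = 2 * m + A"
  obtain j where j: "\<And>i. i < K \<Longrightarrow> R \<le> length (w j i)"
      "\<And>i r. i < K \<Longrightarrow> r < R \<Longrightarrow> w j i ! r = pre i r \<and> rev (w j i) ! r = suf i r"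
    using lim[of R] by blast
  have marked: "mark x (c + int (length (w j i)) + off i i') (y i i')"
    if i: "i < K" "i' < K" and x: "spells x c (w j i @ w j i')" for i i' x c
    unfolding mark_iff
  proof (intro allI impI)
    fix k assume k: "- int A \<le> k" "k < int A"
    have "x (c + int (length (w j i)) + (k + off i i')) = junction pre suf i i' (k + off i i')"
      by (rule junction_in_word[OF x j(1)[OF i(1)] j(1)[OF i(2)]])
        (use j(2)[OF i(1)] j(2)[OF i(2)] m[OF i] k in \<open>auto simp: R_def\<close>)
    then show "x (c + int (length (w j i)) + off i i' + k) = y i i' k"
      by (simp add: off algebra_simps)
  qed
  have long: "2 * m + A \<le> length (w j i)" if "i < K" for i using j(1)[OF that] by (simp add: R_def)
  obtain E0 where E0: "valid E0" "card E0 \<le> K ^ 3"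
    "\<forall>x. tiled K (w j) x \<longrightarrow> reads E0 x"
    using junction_graph[of K y off m "w j", OF yV m long marked] .
  have "reads E0 x" if "x \<in> X" for x using E0(3) tiled[OF that] by blast
  then obtain E where E: "irreducible E" "card E \<le> card E0" "\<And>x. x \<in> X \<Longrightarrow> reads E x"
    using irreducible_exists[OF E0(1), of X] by blast
  have "card F \<le> (card E + card V)\<^sup>2"
  proof (rule card_branching_le[OF E(1)])
    show "reads E (f C) \<and> reads E (f' C) \<and> (\<forall>i<0. f C i = f' C i) \<and> f C 0 \<noteq> f' C 0"
      if "C \<in> F" for C using f[OF that] E(3) by blast
    show "\<exists>i. - int A \<le> i \<and> i < 0 \<and> f C i \<noteq> f C' i" if C: "C \<in> F" "C' \<in> F" "C \<noteq> C'" for C C'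
    proof -
      obtain i where "i < 0" "- int L \<le> i" "f C i \<noteq> f C' i" using L[OF C] by blast
      then show ?thesis using DA(2) by (intro exI[of _ i]) auto
    qed
  qed
  also have "\<dots> \<le> (K ^ 3 + K\<^sup>2)\<^sup>2"
    using E(2) E0(2) V(2) by (intro power_mono) auto
  finally show ?thesis .
qed

section \<open>S-adic subshifts and their asymptotic classes\<close>

lemma foldr_comp: "foldr (\<lambda>i f. \<tau> i \<circ> f) xs g = foldr (\<lambda>i f. \<tau> i \<circ> f) xs id \<circ> g"
  by (induction xs) (auto simp: comp_assoc)

lemma block_split:
  assumes "n \<le> N"
  shows "block \<tau> 0 N = block \<tau> 0 n \<circ> block \<tau> n N"
proof -
  have "[0..<N] = [0..<n] @ [n..<N]" using upt_add_eq_append[of 0 n "N - n"] assms by simp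
  then show ?thesis by (simp add: block_def foldr_comp[of \<tau> _ "foldr _ _ _"])
qed

lemma block_step: "n < N \<Longrightarrow> block \<tau> n N = \<tau> n \<circ> block \<tau> (Suc n) N"
  by (simp add: block_def upt_rec[of n N])

lemma block_morphism:
  assumes "directive_sequence \<A> \<tau>" "n \<le> N"
  shows "semigroup_morphism (\<A> N) (\<A> n) (block \<tau> n N)"
  using assms(2)
proof (induction rule: inc_induct)
  case base
  then show ?case by (simp add: block_def semigroup_morphism_def)
next
  case (step n)
  have "semigroup_morphism (\<A> (Suc n)) (\<A> n) (\<tau> n)"
    using assms(1) by (simp add: directive_sequence_def)
  then show ?case
    using step by (auto simp: semigroup_morphism_def block_step)
qed

lemma morphism_concat:
  assumes "semigroup_morphism A B f" "u \<in> words A"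
  shows "f u = concat (map (\<lambda>a. f [a]) u)"
proof -
  have "u \<noteq> []" using assms(2) by (simp add: words_def)
  then show ?thesis
    using assms(2)
  proof (induction u rule: list_nonempty_induct)
    case (cons a u)
    then have "[a] \<in> words A" "u \<in> words A" by (auto simp: words_def)
    then have "f ([a] @ u) = f [a] @ f u"
      using assms(1) unfolding semigroup_morphism_def by blast
    then show ?case using cons \<open>u \<in> words A\<close> by simp
  qed simp
qed

text \<open>An empty alphabet forces all later ones to be empty, and then \<open>min_length\<close> has the constant
  value \<open>Min {}\<close>.\<close>

lemma alphabet_nonempty:
  assumes "directive_sequence \<A> \<tau>" "everywhere_growing \<A> \<tau>"
  shows "\<A> n \<noteq> {}"
proof
  assume empty: "\<A> n = {}"
  have "\<A> N = {}" if "n \<le> N" for N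
    using that
  proof (induction rule: dec_induct)
    case (step N)
    have "\<tau> N u \<in> words (\<A> N)" if "u \<in> words (\<A> (Suc N))" for u
      using assms(1) that by (auto simp: directive_sequence_def semigroup_morphism_def)
    then have "words (\<A> (Suc N)) = {}" using step by (auto simp: words_def)
    then have "[a] \<notin> words (\<A> (Suc N))" for a by simp
    then show ?case by (auto simp: words_def)
  qed (use empty in simp)
  then have "min_length (\<A> N) (block \<tau> 0 N) = Min {}" if "n \<le> N" for N
    using that by (simp add: min_length_def)
  moreover obtain N0 where "\<And>N. N0 \<le> N \<Longrightarrow> Suc (Min {}) \<le> min_length (\<A> N) (block \<tau> 0 N)"
    using assms(2) unfolding everywhere_growing_def filterlim_at_top eventually_sequentially by blast
  ultimately show False by (metis max.cobounded1 max.cobounded2 not_less_eq_eq order_refl)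
qed

lemma long_blocks:
  assumes "directive_sequence \<A> \<tau>" "everywhere_growing \<A> \<tau>"
  obtains N0 where "\<forall>N\<ge>N0. \<forall>a\<in>\<A> N. R \<le> length (block \<tau> 0 N [a])"
proof -
  obtain N0 where N0: "\<And>N. N0 \<le> N \<Longrightarrow> R \<le> min_length (\<A> N) (block \<tau> 0 N)"
    using assms(2) unfolding everywhere_growing_def filterlim_at_top eventually_sequentially by blast
  have "R \<le> length (block \<tau> 0 N [a])" if "N0 \<le> N" "a \<in> \<A> N" for N a
  proof -
    have "finite (\<A> N)" using assms(1) by (simp add: directive_sequence_def)
    then have "min_length (\<A> N) (block \<tau> 0 N) \<le> length (block \<tau> 0 N [a])"
      unfolding min_length_def using that(2) by (intro Min_le) auto
    then show ?thesis using N0[OF that(1)] by simp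
  qed
  then show ?thesis using that by blast
qed

lemma small_level:
  assumes "liminf (\<lambda>n. enat (card (\<A> n))) = enat K"
  obtains n where "j \<le> n" "card (\<A> n) \<le> K"
proof (rule ccontr)
  assume "\<not> thesis"
  then have "\<And>n. j \<le> n \<Longrightarrow> \<not> card (\<A> n) \<le> K" using that by blast
  then have "eventually (\<lambda>n. enat (Suc K) \<le> enat (card (\<A> n))) sequentially"
    unfolding eventually_sequentially by (intro exI[of _ j]) (simp add: Suc_le_eq not_le)
  then have "enat (Suc K) \<le> liminf (\<lambda>n. enat (card (\<A> n)))" by (rule Liminf_bounded)
  then show False using assms by simp
qed

lemma cut_position:
  assumes "\<And>i. i \<in> set us \<Longrightarrow> length (w i) \<le> M" "t \<le> length (concat (map w us))"
  obtains us1 us2 where "us = us1 @ us2" "t \<le> length (concat (map w us1))"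
    "length (concat (map w us1)) \<le> t + M"
  using assms
proof (induction us arbitrary: t thesis)
  case Nil
  then show ?case by simp
next
  case (Cons i us)
  show ?case
  proof (cases "t = 0")
    case True
    show ?thesis by (rule Cons.prems(1)[of "[]" "i # us"]) (use True in auto)
  next
    case False
    show ?thesis
    proof (cases "t \<le> length (w i)")
      case True
      show ?thesis
        by (rule Cons.prems(1)[of "[i]" us]) (use True Cons.prems(2)[of i] in auto)
    next
      case le: False
      have "t - length (w i) \<le> length (concat (map w us))" using Cons.prems(3) by simp
      then obtain us1 us2 where "us = us1 @ us2" "t - length (w i) \<le> length (concat (map w us1))"
        "length (concat (map w us1)) \<le> t - length (w i) + M"
        using Cons.IH[of "t - length (w i)"] Cons.prems(2) by auto
      then show ?thesis using le by (intro Cons.prems(1)[of "i # us1" us2]) auto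
    qed
  qed
qed

text \<open>A window of a concatenation is itself a concatenation up to incomplete words at both ends,
  which cost at most the maximal length \<open>M\<close> of a word.\<close>

lemma tiledI:
  fixes w :: "nat \<Rightarrow> 'a list"
  assumes sub: "\<And>k. k0 \<le> k \<Longrightarrow> \<exists>us. set us \<subseteq> {..<K} \<and>
      sublist (map x [- int k..int k]) (concat (map w us))"
  shows "tiled K w x"
  unfolding tiled_def
proof
  fix N
  define M where "M = (\<Sum>i<K. length (w i))"
  define k where "k = k0 + N + M"
  obtain us where us: "set us \<subseteq> {..<K}" "sublist (map x [- int k..int k]) (concat (map w us))"
    using sub[of k] by (auto simp: k_def)
  obtain ps ss where ps: "concat (map w us) = ps @ map x [- int k..int k] @ ss"
    using us(2) by (auto simp: sublist_def)
  have len: "length (map x [- int k..int k]) = 2 * k + 1" by simp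
  have M: "length (w i) \<le> M" if "i \<in> set us" for i
    using member_le_sum[of i "{..<K}" "\<lambda>i. length (w i)"] us(1) that by (auto simp: M_def)
  obtain a b where a: "us = a @ b" "length ps \<le> length (concat (map w a))"
    "length (concat (map w a)) \<le> length ps + M"
    using cut_position[of us w M "length ps"] M ps by auto
  have "length ps + (2 * k + 1 - M) \<le> length (concat (map w us))" unfolding ps using len by simp
  then obtain a' b' where a': "us = a' @ b'" "length ps + (2 * k + 1 - M) \<le> length (concat (map w a'))"
    "length (concat (map w a')) \<le> length ps + (2 * k + 1 - M) + M"
    using cut_position[of us w M "length ps + (2 * k + 1 - M)"] M by blast
  have kM: "M \<le> k" "N + M \<le> k" by (simp_all add: k_def)
  have le: "length (concat (map w a)) \<le> length (concat (map w a'))"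
    using a(3) a'(2) kM by linarith
  from a(1) a'(1) consider m where "a' = a @ m" | m where "a = a' @ m"
    by (auto simp: append_eq_append_conv2)
  then obtain m where m: "concat (map w a') = concat (map w a) @ concat (map w m)" "set m \<subseteq> set us"
  proof cases
    case 1
    then show ?thesis using that[of m] a'(1) by auto
  next
    case 2
    then show ?thesis using that[of "[]"] le by simp
  qed
  let ?c = "- int k + (int (length (concat (map w a))) - int (length ps))"
  have "spells x ?c (concat (map w m))"
    unfolding spells_def
  proof (intro allI impI)
    fix r assume r: "r < length (concat (map w m))"
    define s where "s = length (concat (map w a)) - length ps + r"
    have s: "s < 2 * k + 1" using r a(2) a'(3) m(1) kM by (simp add: s_def)
    have "concat (map w m) ! r = concat (map w us) ! (length (concat (map w a)) + r)"
      using r m(1) a'(1) by (simp add: nth_append)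
    also have "\<dots> = (ps @ map x [- int k..int k] @ ss) ! (length ps + s)"
      using a(2) by (simp only: ps) (simp add: s_def)
    also have "\<dots> = x (- int k + int s)" using s len by (simp add: nth_append)
    also have "- int k + int s = ?c + int r" using a(2) by (simp add: s_def)
    finally show "x (?c + int r) = concat (map w m) ! r" by simp
  qed
  moreover have "?c \<le> - int N" using a(3) kM by simp
  moreover have "int N \<le> ?c + int (length (concat (map w m)))"
    using a'(2) m(1) kM by simp
  ultimately show "\<exists>c us. set us \<subseteq> {..<K} \<and> c \<le> - int N \<and>
      int N \<le> c + int (length (concat (map w us))) \<and> spells x c (concat (map w us))"
    using m(2) us(1) by blast
qed

text \<open>A long window cannot occur in \<open>block \<tau> 0 N [a]\<close> with \<open>N < n\<close>, since these finitely many words are bounded in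
  length; for \<open>n \<le> N\<close> the word is a concatenation of words of level \<open>n\<close>.\<close>

lemma sadic_tiled:
  assumes dir: "directive_sequence \<A> \<tau>" and x: "x \<in> sadic_subshift \<A> \<tau>"
    and \<phi>: "\<phi> ` {..<K} = \<A> n"
  shows "tiled K (\<lambda>i. block \<tau> 0 n [\<phi> i]) x"
proof (rule tiledI)
  define B where "B = (\<Sum>N<n. \<Sum>a\<in>\<A> N. length (block \<tau> 0 N [a]))"
  fix k assume k: "B \<le> k"
  obtain N a where N: "a \<in> \<A> N" "sublist (map x [- int k..int k]) (block \<tau> 0 N [a])"
    using x unfolding sadic_subshift_def by blast
  have "n \<le> N"
  proof (rule ccontr)
    assume "\<not> n \<le> N"
    have "finite (\<A> N)" using dir by (simp add: directive_sequence_def)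
    then have "length (block \<tau> 0 N [a]) \<le> (\<Sum>a\<in>\<A> N. length (block \<tau> 0 N [a]))"
      using N(1) by (intro member_le_sum) auto
    also have "\<dots> \<le> B"
      unfolding B_def using \<open>\<not> n \<le> N\<close>
      by (intro member_le_sum[of N "{..<n}" "\<lambda>N. \<Sum>a\<in>\<A> N. length (block \<tau> 0 N [a])"]) auto
    finally have "length (block \<tau> 0 N [a]) \<le> k" using k by simp
    moreover have "2 * k + 1 \<le> length (block \<tau> 0 N [a])"
      using sublist_length_le[OF N(2)] by simp
    ultimately show False by simp
  qed
  have "[a] \<in> words (\<A> N)" using N(1) by (simp add: words_def)
  then have v: "block \<tau> n N [a] \<in> words (\<A> n)"
    using block_morphism[OF dir \<open>n \<le> N\<close>] by (simp add: semigroup_morphism_def)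
  then have "set (block \<tau> n N [a]) \<subseteq> \<phi> ` {..<K}" unfolding \<phi> words_def by auto
  then have "block \<tau> n N [a] \<in> map \<phi> ` lists {..<K}" by (simp add: in_lists_conv_set subset_iff flip: lists_image)
  then obtain us where us: "block \<tau> n N [a] = map \<phi> us" "set us \<subseteq> {..<K}" by auto
  have "block \<tau> 0 N [a] = concat (map (\<lambda>a. block \<tau> 0 n [a]) (block \<tau> n N [a]))"
    using block_split[OF \<open>n \<le> N\<close>, of \<tau>] morphism_concat[OF block_morphism[OF dir, of 0 n] v] by simp
  also have "\<dots> = concat (map (\<lambda>i. block \<tau> 0 n [\<phi> i]) us)" by (simp add: us(1) comp_def)
  finally show "\<exists>us. set us \<subseteq> {..<K} \<and>
      sublist (map x [- int k..int k]) (concat (map (\<lambda>i. block \<tau> 0 n [\<phi> i]) us))"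
    using N(2) us(2) by auto
qed

lemma sadic_shift_invariant:
  assumes "x \<in> sadic_subshift \<A> \<tau>"
  shows "shift_pow t x \<in> sadic_subshift \<A> \<tau>"
proof -
  have "\<exists>N>0. \<exists>a\<in>\<A> N. sublist (map (shift_pow t x) [- int k..int k]) (block \<tau> 0 N [a])" for k
  proof -
    define m where "m = k + nat \<bar>t\<bar>"
    obtain N a where N: "N > 0" "a \<in> \<A> N" "sublist (map x [- int m..int m]) (block \<tau> 0 N [a])"
      using assms unfolding sadic_subshift_def by blast
    have "map (shift_pow t x) [- int k..int k] = map x [- int k + t..int k + t]"
      by (rule nth_equalityI) (auto simp: shift_pow_def algebra_simps)
    moreover have "[- int m..int m] = [- int m..- int k + t - 1] @ [- int k + t..int k + t] @
        [int k + t + 1..int m]"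
      using upto_split1[of "- int m" "- int k + t" "int m"]
        upto_split2[of "- int k + t" "int k + t" "int m"] by (simp add: m_def)
    ultimately have "sublist (map (shift_pow t x) [- int k..int k]) (map x [- int m..int m])"
      by simp
    then show ?thesis using N sublist_order.order_trans by blast
  qed
  moreover have "range (shift_pow t x) \<subseteq> \<A> 0"
    using assms by (auto simp: sadic_subshift_def shift_pow_def)
  ultimately show ?thesis by (simp add: sadic_subshift_def)
qed

text \<open>A class that is not an orbit contains points of different orbits; align their common pasts and
  shift the first disagreement to position \<open>0\<close>.\<close>

lemma asymptotic_class_pair:
  assumes inv: "\<And>x t. x \<in> X \<Longrightarrow> shift_pow t x \<in> X"
    and C: "C \<in> asymptotic_classes X"
  obtains x x' where "x \<in> C" "x \<in> X" "x' \<in> X" "\<forall>i<0. x i = x' i" "x 0 \<noteq> x' 0"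
proof -
  obtain x0 where x0: "x0 \<in> X" "C = asymptotic_rel X `` {x0}" "C \<noteq> orbit x0"
    using C unfolding asymptotic_classes_def by (auto elim: quotientE)
  have "shift_pow t x0 \<in> C" for t
  proof -
    have "asymptotic x0 (shift_pow (- t) (shift_pow t x0))"
      by (simp add: asymptotic_iff shift_pow_def)
    then show ?thesis using x0(1,2) inv[OF x0(1)] by (auto simp: asymptotic_rel_def)
  qed
  then have orb: "orbit x0 \<subseteq> C" by (auto simp: orbit_def)
  then obtain x1 where x1: "x1 \<in> C" "x1 \<notin> orbit x0" using x0(3) by blast
  then obtain k l where kl: "x1 \<in> X" "\<And>n. n < l \<Longrightarrow> x0 n = x1 (n + k)"
    using x0(2) by (auto simp: asymptotic_rel_def asymptotic_iff shift_pow_def)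
  have "x0 \<noteq> shift_pow k x1"
  proof
    assume "x0 = shift_pow k x1"
    then have "x1 = shift_pow (- k) x0" by (simp add: shift_pow_def fun_eq_iff)
    then show False using x1(2) by (auto simp: orbit_def)
  qed
  then obtain i where i: "x0 i \<noteq> x1 (i + k)" by (auto simp: shift_pow_def fun_eq_iff)
  have il: "l \<le> i" using kl(2)[of i] i by force
  define d where "d = (LEAST d. x0 (l + int d) \<noteq> x1 (l + int d + k))"
  have d: "x0 (l + int d) \<noteq> x1 (l + int d + k)"
    unfolding d_def by (rule LeastI[of _ "nat (i - l)"]) (use i il in simp)
  have "x0 n = x1 (n + k)" if "n < l + int d" for n
  proof (cases "n < l")
    case False
    then have "nat (n - l) < d" using that by simp
    then show ?thesis using not_less_Least[of "nat (n - l)"] False unfolding d_def by fastforce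
  qed (rule kl(2))
  then have "\<forall>i<0. shift_pow (l + int d) x0 i = shift_pow (l + int d + k) x1 i"
    by (auto simp: shift_pow_def add.assoc)
  moreover have "shift_pow (l + int d) x0 0 \<noteq> shift_pow (l + int d + k) x1 0"
    using d by (simp add: shift_pow_def)
  moreover have "shift_pow (l + int d) x0 \<in> C" using orb by (auto simp: orbit_def)
  ultimately show ?thesis using that inv x0(1) kl(1) by blast
qed

lemma asymptotic_class_unique:
  assumes "C \<in> asymptotic_classes X" "C' \<in> asymptotic_classes X" "x \<in> C" "x' \<in> C'"
    "\<forall>i<0. x i = x' i"
  shows "C = C'"
proof -
  have q: "C \<in> X // asymptotic_rel X" "C' \<in> X // asymptotic_rel X"
    using assms by (auto simp: asymptotic_classes_def)
  have "x \<in> X" "x' \<in> X"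
    using q assms(3,4) in_quotient_imp_subset[OF equiv_asymptotic_rel] by blast+
  moreover have "asymptotic x (shift_pow 0 x')" unfolding asymptotic_iff using assms(5) by auto
  ultimately have "(x, x') \<in> asymptotic_rel X" unfolding asymptotic_rel_def by blast
  then show ?thesis
    using quotient_eqI[OF equiv_asymptotic_rel q assms(3,4)] by blast
qed

theorem theorem1p3:
  fixes \<A> :: "nat \<Rightarrow> 'a set" and \<tau> :: "nat \<Rightarrow> 'a list \<Rightarrow> 'a list" and K :: nat
  assumes "directive_sequence \<A> \<tau>"
    and "everywhere_growing \<A> \<tau>"
    and "liminf (\<lambda>n. enat (card (\<A> n))) = enat K"
  shows "finite (asymptotic_classes (sadic_subshift \<A> \<tau>)) \<and>
         card (asymptotic_classes (sadic_subshift \<A> \<tau>)) \<le> 122 * K ^ 7"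
proof -
  define X where "X = sadic_subshift \<A> \<tau>"
  have fin: "finite (\<A> n)" for n using assms(1) by (simp add: directive_sequence_def)
  have ne: "\<A> n \<noteq> {}" for n by (rule alphabet_nonempty[OF assms(1,2)])
  have "\<exists>n. j \<le> n \<and> card (\<A> n) \<le> K" for j using small_level[OF assms(3)] by blast
  then obtain n where n: "\<And>j. j \<le> n j" "\<And>j. card (\<A> (n j)) \<le> K" by metis
  have "\<exists>\<phi>. \<phi> ` {..<K} = \<A> (n j)" for j
  proof -
    obtain h where h: "bij_betw h {..<card (\<A> (n j))} (\<A> (n j))"
      using ex_bij_betw_nat_finite[OF fin[of "n j"]] by (auto simp: atLeast0LessThan)
    \<comment> \<open>the level may have fewer than \<open>K\<close> letters; then one letter is listed several times\<close>
    define \<phi> where "\<phi> i = (if i < card (\<A> (n j)) then h i else h 0)" for i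
    have "0 < card (\<A> (n j))" using fin ne by (simp add: card_gt_0_iff)
    then have "\<phi> ` {..<K} = h ` {..<card (\<A> (n j))}"
      using n(2)[of j] by (force simp: \<phi>_def)
    then show ?thesis using h by (auto simp: bij_betw_def)
  qed
  then obtain \<phi> where \<phi>: "\<And>j. \<phi> j ` {..<K} = \<A> (n j)" by metis
  define w where "w j i = block \<tau> 0 (n j) [\<phi> j i]" for j i
  have \<phi>_in: "\<phi> j i \<in> \<A> (n j)" if "i < K" for j i using \<phi>[of j] that by blast
  have S: "set (w j i) \<subseteq> \<A> 0" if "i < K" for j i
  proof -
    have "[\<phi> j i] \<in> words (\<A> (n j))" using \<phi>_in[OF that] by (simp add: words_def)
    then have "w j i \<in> words (\<A> 0)"
      using block_morphism[OF assms(1), of 0 "n j"] by (simp add: w_def semigroup_morphism_def)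
    then show ?thesis by (auto simp: words_def)
  qed
  have grow: "\<exists>j0. \<forall>j\<ge>j0. \<forall>i<K. R \<le> length (w j i)" for R
  proof -
    obtain N0 where N0: "\<forall>N\<ge>N0. \<forall>a\<in>\<A> N. R \<le> length (block \<tau> 0 N [a])"
      using long_blocks[OF assms(1,2), of R] .
    have "R \<le> length (w j i)" if "N0 \<le> j" "i < K" for j i
      unfolding w_def using n(1)[of j] that \<phi>_in[OF that(2)] by (intro N0[rule_format]) auto
    then show ?thesis by blast
  qed
  have tiled: "tiled K (w j) x" if "x \<in> X" for x j
    unfolding w_def using sadic_tiled[OF assms(1) _ \<phi>] that by (simp add: X_def)
  have inv: "shift_pow t x \<in> X" if "x \<in> X" for x t
    using sadic_shift_invariant that by (simp add: X_def)
  have "\<exists>p. fst p \<in> C \<and> fst p \<in> X \<and> snd p \<in> X \<and> (\<forall>i<0. fst p i = snd p i) \<and> fst p 0 \<noteq> snd p 0"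
    if C: "C \<in> asymptotic_classes X" for C
  proof -
    obtain x x' where "x \<in> C" "x \<in> X" "x' \<in> X" "\<forall>i<0. x i = x' i" "x 0 \<noteq> x' 0"
      using asymptotic_class_pair[OF inv C] .
    then show ?thesis by (intro exI[of _ "(x, x')"]) simp
  qed
  then obtain p where p: "\<And>C. C \<in> asymptotic_classes X \<Longrightarrow> fst (p C) \<in> C \<and> fst (p C) \<in> X \<and>
      snd (p C) \<in> X \<and> (\<forall>i<0. fst (p C) i = snd (p C) i) \<and> fst (p C) 0 \<noteq> snd (p C) 0"
    by metis
  have "card F \<le> (K ^ 3 + K\<^sup>2)\<^sup>2" if F: "F \<subseteq> asymptotic_classes X" "finite F" for F
  proof (rule card_asymptotic_pairs_of_tiled_points_le[where w = w and S = "\<A> 0" and X = X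
        and f = "\<lambda>C. fst (p C)" and f' = "\<lambda>C. snd (p C)"])
    show "fst (p C) \<in> X \<and> snd (p C) \<in> X \<and> (\<forall>i<0. fst (p C) i = snd (p C) i) \<and>
        fst (p C) 0 \<noteq> snd (p C) 0" if "C \<in> F" for C
      using p[of C] F(1) that by blast
    show "\<exists>i<0. fst (p C) i \<noteq> fst (p C') i" if C: "C \<in> F" "C' \<in> F" "C \<noteq> C'" for C C'
      using asymptotic_class_unique[of C X C' "fst (p C)" "fst (p C')"] p[of C] p[of C'] F(1) C by blast
  qed (use S grow tiled fin F in auto)
  then have "finite (asymptotic_classes X) \<and> card (asymptotic_classes X) \<le> (K ^ 3 + K\<^sup>2)\<^sup>2"
    by (intro finite_if_finite_subsets_card_bdd) blast
  moreover have "(K ^ 3 + K\<^sup>2)\<^sup>2 \<le> 122 * K ^ 7"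
  proof -
    have "0 < K" using n(2)[of 0] fin ne by (metis card_gt_0_iff gr0I le_zero_eq not_less_zero)
    then have "K\<^sup>2 \<le> K ^ 3" "(K ^ 3)\<^sup>2 \<le> K ^ 7"
      by (simp_all add: power_increasing flip: power_mult)
    then have "(K ^ 3 + K\<^sup>2)\<^sup>2 \<le> (2 * K ^ 3)\<^sup>2" by (intro power_mono) auto
    also have "\<dots> = 4 * (K ^ 3)\<^sup>2" by (simp add: power_mult_distrib)
    also have "\<dots> \<le> 122 * K ^ 7" using \<open>(K ^ 3)\<^sup>2 \<le> K ^ 7\<close> by simp
    finally show ?thesis .
  qed
  ultimately show ?thesis by (simp add: X_def)
qed

end
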